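(* Consider $$u_t=\frac1{m+1}(u^{m+1})_{xx}+u^p(1-u)(u-a)\qquad(\mathrm{E})$$ with $m=3/4$, $p=1/4$, $a=0.3$. Then there exist $c_\ast\in[-1.5\times10^{-6},1.5\times10^{-6}]$ and finite values $\xi_{\min}<\xi_{\max}$ such that $u(t,x)=\phi(x-c_\ast t)$ with $$\phi(\xi)=\begin{cases}\varphi(\xi)&\xi\in(\xi_{\min},\xi_{\max}),\\0&\xi\in\mathbb{R}\setminus(\xi_{\min},\xi_{\max})\end{cases}$$ is a compacton traveling wave solution of (E) with speed $c_\ast$, where $\varphi$, re-expressed in the desingularized frame variable $z$, is the first component of an orbit homoclinic to $(\phi,\psi)=(0,0)$ of $$\dot\phi=\psi,\qquad\dot\psi=-c_\ast\psi-\phi(1-\phi)(\phi-a).\qquad(\mathrm{D})$$ The equilibrium $(0,0)$ is contained in the isolating block $N=PB$ for (D), where $P=[V_1\ V_2]$ is the eigenmatrix, with columns in the enclosures $$V_1\in\begin{pmatrix}[0.87714184587409483,\,0.87714960433934953]\\ [0.48042765940975440,\,0.48043734031068247]\end{pmatrix},\quad V_2\in\begin{pmatrix}[-0.87714960433700939,\,-0.87714184587344934]\\ [0.48042765939685023,\,0.48043734034727664]\end{pmatrix},$$ and $$B=([-1.0000068275040609,\,1.0000038705938853]\times10^{-6})\times([-1.0000261784559085,\,1.0000461805915562]\times10^{-7}).$$ Finally, $$\xi_{\max}-\xi_{\min}=|\operatorname{supp}u|\in[5.7503277707,\,5.8115725019],$$ where $|\operatorname{supp}u|$ is the length of the support of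 $u(t,\cdot)$.
   Context: Weak solution of $u_t=d(u^{m+1})_{xx}+f(u)$, $d=1/(m+1)$, with initial datum $u_0\in C^0(\mathbb{R})$, $0\le u_0\le1$: a nonnegative $u$ such that for each $r,T>0$, with $Q_T=(0,T)\times\mathbb{R}$, $u\in C(Q_T)\cap L^\infty(Q_T)$ and $$\int_0^T\!\!\int_{-r}^r\{u\phi_t+d\,u^{m+1}\phi_{xx}+f(u)\phi\}dxdt=\int_{-r}^r\{u(T,x)\phi(T,x)-u_0(x)\phi(0,x)\}dx+d\int_0^T\{u^{m+1}(t,r)\phi_x(t,r)-u^{m+1}(t,-r)\phi_x(t,-r)\}dt$$ for all $\phi\in C^{2,1}(\overline{Q_T})$ with $\phi\ge0$, $\phi(t,\pm r)=0$ on $[0,T]$. A traveling wave solution with speed $c$ is a weak solution $u(t,x)=\phi(x-ct)$; it is a compacton traveling wave if its profile $\phi$ has compact support (speed $0$ allowed). The wave variable $\xi=x-ct$ and the desingularized variable $z$ are related by $dz/d\xi=\phi(\xi)^{-m}$; dots in (D) denote $d/dz$. $P$ is a matrix of eigenvectors of the linearization of (D) at $(0,0)$ and $PB=\{Py\mid y\in B\}$. Isolating block: a compact $N$ with $\partial N=N^{\rm exit}\cup N^{\rm ent}$, $N^{\rm exit}$ closed in $\partial N$. A point $x\in\partial N$ is an exit (resp. entrance) point if for every solution $\sigma:[-\delta_1,\delta_2]\to\mathbb{R}^2$ with $\sigma(0)=x$, $\delta_1\ge0$, $\delta_2>0$, there are $0\le\epsilon_1\le\delta_1$, $0<\epsilon_2\le\delta_2$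 with $\sigma(t)\notin N$ (resp. $\in{\rm int}\,N$) for $0<t\le\epsilon_2$ and $\sigma(t)\notin\partial N$ (resp. $\notin N$) for $-\epsilon_1\le t<0$. *)

theory Defs
  imports "HOL-Analysis.Analysis"
begin

text \<open>
  Test functions of class \<open>C\<^sup>2\<^sup>,\<^sup>1\<close> (twice in space, once in time) on the closed strip
  \<open>[0,T] \<times> \<real>\<close>; the arguments \<open>\<psi>t\<close>, \<open>\<psi>x\<close>, \<open>\<psi>xx\<close> are the partial derivatives, the time derivative
  being one-sided at \<open>t = 0\<close> and \<open>t = T\<close>.
\<close>

definition C21_strip ::
  "real \<Rightarrow> (real \<Rightarrow> real \<Rightarrow> real) \<Rightarrow> (real \<Rightarrow> real \<Rightarrow> real) \<Rightarrow> (real \<Rightarrow> real \<Rightarrow> real) \<Rightarrow>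
   (real \<Rightarrow> real \<Rightarrow> real) \<Rightarrow> bool" where
  "C21_strip T \<psi> \<psi>t \<psi>x \<psi>xx \<longleftrightarrow>
     (\<forall>g\<in>{\<psi>, \<psi>t, \<psi>x, \<psi>xx}. continuous_on ({0..T} \<times> UNIV) (\<lambda>(t, x). g t x)) \<and>
     (\<forall>t\<in>{0..T}. \<forall>x.
        ((\<lambda>s. \<psi> s x) has_real_derivative \<psi>t t x) (at t within {0..T}) \<and>
        ((\<lambda>y. \<psi> t y) has_real_derivative \<psi>x t x) (at x) \<and>
        ((\<lambda>y. \<psi>x t y) has_real_derivative \<psi>xx t x) (at x))"

text \<open>
  Weak solutions of \<open>u\<^sub>t = d (u\<^sup>m\<^sup>+\<^sup>1)\<^sub>x\<^sub>x + f(u)\<close>, \<open>d = 1/(m+1)\<close>, with initial datum \<open>u0\<close>.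
  For continuous \<open>f\<close> all integrands below are bounded and continuous off null sets, so the
  gauge integrals are Lebesgue integrals.
\<close>

definition weak_solution ::
  "real \<Rightarrow> (real \<Rightarrow> real) \<Rightarrow> (real \<Rightarrow> real) \<Rightarrow> (real \<Rightarrow> real \<Rightarrow> real) \<Rightarrow> bool" where
  "weak_solution m f u0 u \<longleftrightarrow>
     continuous_on UNIV u0 \<and> (\<forall>x. 0 \<le> u0 x \<and> u0 x \<le> 1) \<and>
     (\<forall>t>0. \<forall>x. u t x \<ge> 0) \<and>
     (\<forall>r>0. \<forall>T>0.
        continuous_on ({0<..<T} \<times> UNIV) (\<lambda>(t, x). u t x) \<and>
        (\<exists>M. AE (t, x) in lborel. (t, x) \<in> {0<..<T} \<times> UNIV \<longrightarrow> \<bar>u t x\<bar> \<le> M) \<and>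
        (\<forall>\<psi> \<psi>t \<psi>x \<psi>xx.
           C21_strip T \<psi> \<psi>t \<psi>x \<psi>xx \<longrightarrow>
           (\<forall>t\<in>{0..T}. \<forall>x. \<psi> t x \<ge> 0) \<longrightarrow>
           (\<forall>t\<in>{0..T}. \<psi> t r = 0 \<and> \<psi> t (-r) = 0) \<longrightarrow>
           integral {0..T} (\<lambda>t. integral {-r..r} (\<lambda>x.
               u t x * \<psi>t t x + 1 / (m + 1) * u t x powr (m + 1) * \<psi>xx t x + f (u t x) * \<psi> t x))
           = integral {-r..r} (\<lambda>x. u T x * \<psi> T x - u0 x * \<psi> 0 x)
             + 1 / (m + 1) * integral {0..T} (\<lambda>t.
                 u t r powr (m + 1) * \<psi>x t r - u t (-r) powr (m + 1) * \<psi>x t (-r))))"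

definition traveling_wave :: "real \<Rightarrow> (real \<Rightarrow> real) \<Rightarrow> real \<Rightarrow> (real \<Rightarrow> real) \<Rightarrow> bool" where
  "traveling_wave m f c \<phi> \<longleftrightarrow> weak_solution m f \<phi> (\<lambda>t x. \<phi> (x - c * t))"

definition supp :: "(real \<Rightarrow> real) \<Rightarrow> real set" where
  "supp g = closure {x. g x \<noteq> 0}"

definition compacton_traveling_wave ::
  "real \<Rightarrow> (real \<Rightarrow> real) \<Rightarrow> real \<Rightarrow> (real \<Rightarrow> real) \<Rightarrow> bool" where
  "compacton_traveling_wave m f c \<phi> \<longleftrightarrow> traveling_wave m f c \<phi> \<and> compact (supp \<phi>)"

text \<open>
  The profile equation \<open>-c \<phi>' = (\<phi>\<^sup>m \<phi>')' + \<phi>\<^sup>p (1 - \<phi>) (\<phi> - a)\<close> with \<open>m + p = 1\<close>, written for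
  \<open>Y = (\<phi>, \<phi>\<^sup>m \<phi>')\<close> in the variable \<open>z\<close> with \<open>dz/d\<xi> = \<phi>\<^sup>-\<^sup>m\<close>.
\<close>

definition D_field :: "real \<Rightarrow> real \<Rightarrow> real^2 \<Rightarrow> real^2" where
  "D_field a c Y = vector [Y $ 2, - c * Y $ 2 - Y $ 1 * (1 - Y $ 1) * (Y $ 1 - a)]"

definition solution_on :: "(real^2 \<Rightarrow> real^2) \<Rightarrow> real set \<Rightarrow> (real \<Rightarrow> real^2) \<Rightarrow> bool" where
  "solution_on F I \<sigma> \<longleftrightarrow> (\<forall>t\<in>I. (\<sigma> has_vector_derivative F (\<sigma> t)) (at t within I))"

definition homoclinic_orbit :: "(real^2 \<Rightarrow> real^2) \<Rightarrow> real^2 \<Rightarrow> (real \<Rightarrow> real^2) \<Rightarrow> bool" where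
  "homoclinic_orbit F q Y \<longleftrightarrow>
     F q = 0 \<and> solution_on F UNIV Y \<and> (\<exists>z. Y z \<noteq> q) \<and>
     (Y \<longlongrightarrow> q) at_top \<and> (Y \<longlongrightarrow> q) at_bot"

definition eigenmatrix_at :: "(real^2 \<Rightarrow> real^2) \<Rightarrow> real^2 \<Rightarrow> real^2^2 \<Rightarrow> bool" where
  "eigenmatrix_at F q P \<longleftrightarrow>
     F differentiable (at q) \<and> invertible P \<and>
     (\<forall>j. column j P \<noteq> 0 \<and> (\<exists>l. jacobian F (at q) *v column j P = l *\<^sub>R column j P))"

text \<open>
  In the next two definitions \<open>\<epsilon>1 = 0\<close> is allowed, also when \<open>\<delta>1 > 0\<close>; the backward condition is
  then void.
\<close>

definition exit_point :: "(real^2 \<Rightarrow> real^2) \<Rightarrow> (real^2) set \<Rightarrow> real^2 \<Rightarrow> bool" where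
  "exit_point F N x \<longleftrightarrow> x \<in> frontier N \<and>
     (\<forall>\<delta>1 \<delta>2 \<sigma>. \<delta>1 \<ge> 0 \<and> \<delta>2 > 0 \<and> solution_on F {-\<delta>1..\<delta>2} \<sigma> \<and> \<sigma> 0 = x \<longrightarrow>
        (\<exists>\<epsilon>1 \<epsilon>2. 0 \<le> \<epsilon>1 \<and> \<epsilon>1 \<le> \<delta>1 \<and> 0 < \<epsilon>2 \<and> \<epsilon>2 \<le> \<delta>2 \<and>
           (\<forall>t. 0 < t \<and> t \<le> \<epsilon>2 \<longrightarrow> \<sigma> t \<notin> N) \<and>
           (\<forall>t. -\<epsilon>1 \<le> t \<and> t < 0 \<longrightarrow> \<sigma> t \<notin> frontier N)))"

definition entrance_point :: "(real^2 \<Rightarrow> real^2) \<Rightarrow> (real^2) set \<Rightarrow> real^2 \<Rightarrow> bool" where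
  "entrance_point F N x \<longleftrightarrow> x \<in> frontier N \<and>
     (\<forall>\<delta>1 \<delta>2 \<sigma>. \<delta>1 \<ge> 0 \<and> \<delta>2 > 0 \<and> solution_on F {-\<delta>1..\<delta>2} \<sigma> \<and> \<sigma> 0 = x \<longrightarrow>
        (\<exists>\<epsilon>1 \<epsilon>2. 0 \<le> \<epsilon>1 \<and> \<epsilon>1 \<le> \<delta>1 \<and> 0 < \<epsilon>2 \<and> \<epsilon>2 \<le> \<delta>2 \<and>
           (\<forall>t. 0 < t \<and> t \<le> \<epsilon>2 \<longrightarrow> \<sigma> t \<in> interior N) \<and>
           (\<forall>t. -\<epsilon>1 \<le> t \<and> t < 0 \<longrightarrow> \<sigma> t \<notin> N)))"

definition isolating_block :: "(real^2 \<Rightarrow> real^2) \<Rightarrow> (real^2) set \<Rightarrow> bool" where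
  "isolating_block F N \<longleftrightarrow>
     compact N \<and>
     frontier N = {x. exit_point F N x} \<union> {x. entrance_point F N x} \<and>
     closedin (top_of_set (frontier N)) {x. exit_point F N x}"

end

theory Submission
  imports Defs
begin

text \<open>
  For \<open>c = 0\<close> the system (D) is Hamiltonian and its homoclinic orbit is explicit,
  \<open>\<phi>(z) = 9 / (13 + sqrt 34 cosh (sqrt 0.3 z))\<close>, so the theorem holds with \<open>c = 0\<close>.
  The support has length \<open>\<integral> \<phi>\<^bsup>3/4\<^esup> dz\<close>; a trigonometric substitution turns this into
  an integral over \<open>[0, \<pi>/2]\<close> whose weight is enclosed between two quadratic polynomials in
  \<open>sin\<^sup>2 \<theta>\<close>. The zero extension \<open>u\<close> of the profile is a stationary weak solution because
  the flux \<open>(u\<^bsup>7/4\<^esup>)\<^sub>x\<close> is continuous across the edges of the support. On the block, the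
  linear part of (D) dominates the quadratic remainder, which makes two opposite closed edges exit
  edges and the remaining open edges entrance edges; that entrance points are not vacuously exit
  points needs local existence of solutions.
\<close>

section \<open>Local solutions and isolating blocks\<close>

text \<open>The admissible speeds include 0, the value at which the damping term of (D) disappears
  and energy is conserved. On the zero energy level 1/\<phi> obeys a first-order relation quadratic
  in 1/\<phi>, hence the shifted cosh. What then needs estimating is the length. The wave variable
  is an antiderivative of \<phi>^(3/4) in z, and the exponential decay of \<phi> compresses the
  whole z-axis into a bounded interval, which becomes the support. In the angle variable the
  integrand has no endpoint singularity, because 1 - v^4 contains the factor 1 - v^2 that the
  arcsine supplies. The required interval for the length is about one percent wide, so quadratic
  bounds for the weight are enough. No improper integral is formed: a primitive of the bound,
  evaluated at the angle, plus the wave variable is shown to be monotone in z; this bounds the wave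
  variable at every finite z, and the limit is taken afterwards.\<close>

lemma lipschitz_ode_solution:
  fixes G :: "'a::euclidean_space \<Rightarrow> 'a"
  assumes lip: "\<And>x y. dist (G x) (G y) \<le> K * dist x y"
  obtains \<delta> \<sigma> where "\<delta> > 0" "\<sigma> 0 = x0"
    "\<And>t. t \<in> {0..\<delta>} \<Longrightarrow> (\<sigma> has_vector_derivative G (\<sigma> t)) (at t within {0..\<delta>})"
proof -
  \<comment> \<open>With this length \<open>\<delta> * \<bar>K\<bar> \<le> 1/2\<close>, so the
    Picard map contracts with factor 1/2.\<close>
  define \<delta> where "\<delta> = 1 / (2 * (\<bar>K\<bar> + 1))"
  have \<delta>: "\<delta> > 0" "\<delta> * \<bar>K\<bar> \<le> 1/2"
    unfolding \<delta>_def by (auto simp: field_simps)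
  \<comment> \<open>Freezing time outside [0, \<delta>] lets the Picard map act on bounded
    continuous functions on the whole line, a complete space to which the Banach fixed point theorem
    applies directly.\<close>
  define cl where "cl t = max 0 (min \<delta> t)" for t
  have cl: "cl t \<in> {0..\<delta>}" for t using \<delta> by (auto simp: cl_def)
  have cl_id: "cl t = t" if "t \<in> {0..\<delta>}" for t using that by (auto simp: cl_def)
  have cont_cl: "continuous_on UNIV cl"
    unfolding cl_def by (intro continuous_intros)
  have contG: "continuous_on S G" for S
  proof (rule lipschitz_on_continuous_on)
    have "dist (G x) (G y) \<le> \<bar>K\<bar> * dist x y" for x y
      by (rule order_trans[OF lip]) (simp add: mult_right_mono)
    then show "\<bar>K\<bar>-lipschitz_on S G"
      by (intro lipschitz_onI) auto
  qed
  have contx: "continuous_on S (\<lambda>s. G (apply_bcontfun x s))" for x :: "real \<Rightarrow>\<^sub>C 'a" and S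
    by (rule continuous_on_compose2[OF contG[of UNIV]])
      (auto intro: continuous_on_subset[OF continuous_on_apply_bcontfun])
  define J where "J x t = x0 + integral {0..cl t} (\<lambda>s. G (apply_bcontfun x s))" for x t
  have contJ0: "continuous_on {0..\<delta>} (\<lambda>t. integral {0..t} (\<lambda>s. G (apply_bcontfun x s)))" for x
    by (intro indefinite_integral_continuous_1 integrable_continuous_interval contx)
  have contJ: "continuous_on UNIV (J x)" for x
    unfolding J_def
    by (intro continuous_intros continuous_on_compose2[OF contJ0 cont_cl]) (use cl in auto)
  have J_bcont: "J x \<in> bcontfun" for x
  proof -
    have "range (J x) \<subseteq> J x ` {0..\<delta>}"
    proof safe
      fix t
      have "J x t = J x (cl t)" unfolding J_def using cl cl_id by simp
      then show "J x t \<in> J x ` {0..\<delta>}" using cl by blast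
    qed
    moreover have "bounded (J x ` {0..\<delta>})"
      by (intro compact_imp_bounded compact_continuous_image continuous_on_subset[OF contJ]) auto
    ultimately show ?thesis
      using contJ by (auto simp: bcontfun_def intro: bounded_subset)
  qed
  define T where "T x = Bcontfun (J x)" for x
  have T: "apply_bcontfun (T x) = J x" for x
    unfolding T_def by (rule Bcontfun_inverse[OF J_bcont])
  have contraction: "dist (T x) (T y) \<le> 1/2 * dist x y" for x y
  proof (rule dist_bound)
    fix t
    let ?g = "\<lambda>s. G (apply_bcontfun x s) - G (apply_bcontfun y s)"
    have "dist (J x t) (J y t) = norm (integral {0..cl t} ?g)"
      unfolding J_def dist_norm
      by (subst integral_diff) (auto intro!: integrable_continuous_interval contx)
    also have "\<dots> \<le> (\<bar>K\<bar> * dist x y) * (cl t - 0)"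
    proof (rule integral_bound)
      show "0 \<le> cl t" using cl by auto
      show "continuous_on {0..cl t} ?g" by (intro continuous_intros contx)
      fix s
      have "norm (?g s) \<le> K * dist (apply_bcontfun x s) (apply_bcontfun y s)"
        using lip by (simp add: dist_norm)
      also have "\<dots> \<le> \<bar>K\<bar> * dist x y"
        by (intro mult_mono dist_bounded) auto
      finally show "norm (?g s) \<le> \<bar>K\<bar> * dist x y" .
    qed
    also have "\<dots> \<le> (\<bar>K\<bar> * dist x y) * \<delta>"
      using cl[of t] by (intro mult_left_mono) auto
    also have "\<dots> \<le> 1/2 * dist x y"
      using mult_right_mono[OF \<delta>(2), of "dist x y"] by (simp add: mult_ac)
    finally show "dist (apply_bcontfun (T x) t) (apply_bcontfun (T y) t) \<le> 1/2 * dist x y"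
      by (simp add: T)
  qed
  have "\<exists>!x. T x = x"
    by (rule banach_fix_type[where c="1/2"]) (simp_all only: contraction, simp_all)
  then obtain x where x: "T x = x" by blast
  have fixpoint: "apply_bcontfun x = J x" using T[of x] x by simp
  show thesis
  proof
    show "\<delta> > 0" by fact
    show "apply_bcontfun x 0 = x0"
      using fun_cong[OF fixpoint, of 0] cl_id[of 0] \<delta> by (simp add: J_def)
    fix t assume t: "t \<in> {0..\<delta>}"
    have "((\<lambda>u. x0 + integral {0..u} (\<lambda>s. G (apply_bcontfun x s)))
        has_vector_derivative 0 + G (apply_bcontfun x t)) (at t within {0..\<delta>})"
      by (intro has_vector_derivative_add has_vector_derivative_const
          integral_has_vector_derivative contx t)
    then have "((\<lambda>u. x0 + integral {0..u} (\<lambda>s. G (apply_bcontfun x s)))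
        has_vector_derivative G (apply_bcontfun x t)) (at t within {0..\<delta>})" by simp
    then show "(apply_bcontfun x has_vector_derivative G (apply_bcontfun x t)) (at t within {0..\<delta>})"
    proof (rule has_vector_derivative_transform[OF t, rotated])
      fix u assume "u \<in> {0..\<delta>}"
      then show "apply_bcontfun x u = x0 + integral {0..u} (\<lambda>s. G (apply_bcontfun x s))"
        using fun_cong[OF fixpoint, of u] by (simp add: J_def cl_id)
    qed
  qed
qed

lemma D_field_nth [simp]:
  "D_field a c Y $ 1 = Y $ 2"
  "D_field a c Y $ 2 = - c * Y $ 2 - Y $ 1 * (1 - Y $ 1) * (Y $ 1 - a)"
  by (simp_all add: D_field_def)

text \<open>The cubic is not globally Lipschitz, so its argument is clamped to [-R, R], with
  \<open>R\<close> chosen so that this contains every point at distance at most 1 from the initial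
  first coordinate. As long as the first coordinate has moved by less than 1, clamped and original
  field agree along the solution; a shorter interval guarantees this. Forward time is enough because
  the block definitions admit \<open>\<delta>1 = 0\<close>.\<close>

lemma D_field_local_solution:
  obtains \<delta> \<sigma> where "\<delta> > 0" "solution_on (D_field a c) {0..\<delta>} \<sigma>" "\<sigma> 0 = x0"
proof -
  define R where "R = \<bar>x0 $ 1\<bar> + 1"
  have R: "R > 0" by (simp add: R_def)
  define cl where "cl u = max (- R) (min R u)" for u :: real
  have cl: "\<bar>cl u\<bar> \<le> R" "\<bar>cl u - cl v\<bar> \<le> \<bar>u - v\<bar>" for u v
    using R by (auto simp: cl_def)
  define h where "h u = u * (1 - u) * (u - a)" for u :: real
  define L where "L = (1 + \<bar>a\<bar>) * (2 * R) + \<bar>a\<bar> + 3 * R\<^sup>2"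
  have h_lip: "\<bar>h (cl u) - h (cl v)\<bar> \<le> L * \<bar>u - v\<bar>" for u v
  proof -
    define p q where "p = cl u" and "q = cl v"
    have pq: "\<bar>p\<bar> \<le> R" "\<bar>q\<bar> \<le> R" "\<bar>p - q\<bar> \<le> \<bar>u - v\<bar>" by (simp_all add: p_def q_def cl)
    have eq: "h p - h q = ((1 + a) * (p + q) - a - (p * p + p * q + q * q)) * (p - q)"
      by (simp add: h_def algebra_simps)
    have "\<bar>p * p\<bar> \<le> R * R" "\<bar>p * q\<bar> \<le> R * R" "\<bar>q * q\<bar> \<le> R * R"
      unfolding abs_mult using pq by (intro mult_mono; simp)+
    moreover have "\<bar>(1 + a) * (p + q)\<bar> \<le> (1 + \<bar>a\<bar>) * (2 * R)"
      unfolding abs_mult using pq by (intro mult_mono) auto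
    ultimately have "\<bar>(1 + a) * (p + q) - a - (p * p + p * q + q * q)\<bar> \<le> L"
      unfolding L_def power2_eq_square by linarith
    then show ?thesis
      using pq unfolding p_def[symmetric] q_def[symmetric] eq abs_mult
      by (intro mult_mono) auto
  qed
  define G :: "real^2 \<Rightarrow> real^2" where
    "G Y = vector [Y $ 2, - c * Y $ 2 - h (cl (Y $ 1))]" for Y
  have "dist (G x) (G y) \<le> (1 + \<bar>c\<bar> + L) * dist x y" for x y
  proof -
    have n: "\<bar>x $ i - y $ i\<bar> \<le> dist x y" for i
      using component_le_norm_cart[of "x - y" i] by (simp add: dist_norm)
    have L: "L \<ge> 0" using R by (auto simp: L_def)
    have "dist (G x) (G y) \<le> \<bar>(G x - G y) $ 1\<bar> + \<bar>(G x - G y) $ 2\<bar>"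
      using norm_le_l1_cart[of "G x - G y"] by (simp add: dist_norm sum_2)
    also have "\<dots> = \<bar>x $ 2 - y $ 2\<bar> + \<bar>- c * (x $ 2 - y $ 2) - (h (cl (x $ 1)) - h (cl (y $ 1)))\<bar>"
      by (simp add: G_def algebra_simps)
    also have "\<dots> \<le> \<bar>x $ 2 - y $ 2\<bar> + (\<bar>- c * (x $ 2 - y $ 2)\<bar> + \<bar>h (cl (x $ 1)) - h (cl (y $ 1))\<bar>)"
      by (intro add_left_mono abs_triangle_ineq4)
    also have "\<dots> \<le> dist x y + (\<bar>c\<bar> * dist x y + L * dist x y)"
      using n[of 1] n[of 2] L
      by (intro add_mono order_trans[OF h_lip]) (simp_all add: abs_mult mult_left_mono)
    finally show ?thesis by (simp add: algebra_simps)
  qed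
  then obtain \<delta> \<sigma> where \<delta>: "\<delta> > 0" "\<sigma> 0 = x0"
    and \<sigma>: "\<And>t. t \<in> {0..\<delta>} \<Longrightarrow> (\<sigma> has_vector_derivative G (\<sigma> t)) (at t within {0..\<delta>})"
    using lipschitz_ode_solution[where G=G and ?x0.0=x0] by blast
  have "continuous_on {0..\<delta>} \<sigma>"
    using \<sigma> by (rule continuous_on_vector_derivative)
  then have "continuous (at 0 within {0..\<delta>}) (\<lambda>t. \<sigma> t $ 1)"
    using \<delta> by (intro continuous_component) (auto simp: continuous_on_eq_continuous_within)
  then obtain d where d: "d > 0" "\<And>t. t \<in> {0..\<delta>} \<Longrightarrow> dist t 0 < d \<Longrightarrow> dist (\<sigma> t $ 1) (\<sigma> 0 $ 1) < 1"
    unfolding continuous_within_eps_delta by (meson zero_less_one)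
  define e where "e = min \<delta> (d / 2)"
  have e: "e > 0" "e \<le> \<delta>" "e < d" using d \<delta> by (auto simp: e_def)
  show thesis
  proof
    show "e > 0" "\<sigma> 0 = x0" by fact+
    show "solution_on (D_field a c) {0..e} \<sigma>"
      unfolding solution_on_def
    proof
      fix t assume t: "t \<in> {0..e}"
      have "dist (\<sigma> t $ 1) (x0 $ 1) < 1" using d(2)[of t] t e \<delta> by auto
      then have "cl (\<sigma> t $ 1) = \<sigma> t $ 1" by (auto simp: cl_def R_def dist_real_def)
      then have "G (\<sigma> t) = D_field a c (\<sigma> t)"
        by (simp add: G_def D_field_def h_def)
      then show "(\<sigma> has_vector_derivative D_field a c (\<sigma> t)) (at t within {0..e})"
        using \<sigma>[of t] t e by (auto intro: has_vector_derivative_within_subset)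
    qed
  qed
qed

text \<open>In the coordinates \<open>Q *v x\<close> the block is a box, and each sign hypothesis
  concerns one velocity component on one edge. At a corner the first component alone decides: it
  carries the solution out whatever the second one does. Closedness of the exit set needs the exact
  set of exit points, so the entrance points have to be excluded from it.\<close>

lemma isolating_block_parallelogram:
  fixes F :: "real^2 \<Rightarrow> real^2" and P Q :: "real^2^2" and l u :: "real^2"
  assumes QP: "Q ** P = mat 1"
    and lu: "l $ 1 < u $ 1" "l $ 2 < u $ 2"
    and F1: "\<And>y. y \<in> cbox l u \<Longrightarrow> y $ 1 = u $ 1 \<Longrightarrow> (Q *v F (P *v y)) $ 1 > 0"
      "\<And>y. y \<in> cbox l u \<Longrightarrow> y $ 1 = l $ 1 \<Longrightarrow> (Q *v F (P *v y)) $ 1 < 0"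
    and F2: "\<And>y. y \<in> cbox l u \<Longrightarrow> y $ 2 = u $ 2 \<Longrightarrow> (Q *v F (P *v y)) $ 2 < 0"
      "\<And>y. y \<in> cbox l u \<Longrightarrow> y $ 2 = l $ 2 \<Longrightarrow> (Q *v F (P *v y)) $ 2 > 0"
    and ex: "\<And>x0. \<exists>\<delta> \<sigma>. \<delta> > 0 \<and> solution_on F {0..\<delta>} \<sigma> \<and> \<sigma> 0 = x0"
  shows "isolating_block F ((\<lambda>y. P *v y) ` cbox l u)"
proof -
  have QP: "Q *v (P *v y) = y" "P *v (Q *v y) = y" for y
    using QP matrix_left_right_inverse1[OF QP] by (simp_all add: matrix_vector_mul_assoc)
  have mem2: "y \<in> box l u \<longleftrightarrow> l $ 1 < y $ 1 \<and> y $ 1 < u $ 1 \<and> l $ 2 < y $ 2 \<and> y $ 2 < u $ 2"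
    "y \<in> cbox l u \<longleftrightarrow> l $ 1 \<le> y $ 1 \<and> y $ 1 \<le> u $ 1 \<and> l $ 2 \<le> y $ 2 \<and> y $ 2 \<le> u $ 2" for y
    by (auto simp: mem_box_cart forall_2)
  define N where "N = (\<lambda>y. P *v y) ` cbox l u"
  have inN: "x \<in> N \<longleftrightarrow> Q *v x \<in> cbox l u" for x
    unfolding N_def by (metis (no_types, lifting) QP imageE image_eqI)
  have intN: "interior N = (\<lambda>y. P *v y) ` box l u"
    unfolding N_def interior_cbox[symmetric]
    by (intro interior_injective_linear_image matrix_vector_mul_linear injI) (metis QP(1))
  have inI: "x \<in> interior N \<longleftrightarrow> Q *v x \<in> box l u" for x
    unfolding intN by (metis (no_types, lifting) QP imageE image_eqI)
  have compN: "compact N"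
    unfolding N_def
    by (intro compact_continuous_image matrix_vector_mult_linear_continuous_on compact_cbox)
  have front: "x \<in> frontier N \<longleftrightarrow> Q *v x \<in> cbox l u \<and> Q *v x \<notin> box l u" for x
    using compN by (simp add: frontier_def compact_imp_closed closure_closed inN inI)
  have deriv: "((\<lambda>t. (Q *v \<sigma> t) $ i) has_real_derivative (Q *v F (\<sigma> t)) $ i) (at t within I)"
    if "solution_on F I \<sigma>" "t \<in> I" for \<sigma> I t i
  proof -
    have "bounded_linear (\<lambda>x. (Q *v x) $ i)"
      by (rule bounded_linear_compose[OF bounded_linear_vec_nth matrix_vector_mul_bounded_linear])
    from bounded_linear.has_vector_derivative[OF this]
    show ?thesis
      using that by (simp add: solution_on_def has_real_derivative_iff_has_vector_derivative)
  qed
  have exit: "exit_point F N x"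
    if x: "Q *v x \<in> cbox l u" and face: "(Q *v x) $ 1 = u $ 1 \<or> (Q *v x) $ 1 = l $ 1" for x
    unfolding exit_point_def
  proof (intro conjI allI impI)
    show "x \<in> frontier N" using x face by (auto simp: front mem2)
    fix \<delta>1 \<delta>2 \<sigma>
    assume A: "\<delta>1 \<ge> 0 \<and> \<delta>2 > 0 \<and> solution_on F {-\<delta>1..\<delta>2} \<sigma> \<and> \<sigma> 0 = x"
    then have D: "((\<lambda>t. (Q *v \<sigma> t) $ 1) has_real_derivative (Q *v F x) $ 1) (at 0 within {-\<delta>1..\<delta>2})"
      using deriv[of "{-\<delta>1..\<delta>2}" \<sigma> 0 1] by auto
    obtain d where d: "d > 0" "\<And>t. t > 0 \<Longrightarrow> t \<le> \<delta>2 \<Longrightarrow> t < d \<Longrightarrow> \<sigma> t \<notin> N"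
    proof (cases "(Q *v x) $ 1 = u $ 1")
      case True
      then have "(Q *v F x) $ 1 > 0" using F1(1)[OF x] by (simp add: QP)
      from has_real_derivative_pos_inc_right[OF D this]
      obtain d where "d > 0" "\<forall>h>0. 0 + h \<in> {-\<delta>1..\<delta>2} \<longrightarrow> h < d \<longrightarrow> (Q *v \<sigma> 0) $ 1 < (Q *v \<sigma> (0 + h)) $ 1"
        by blast
      then show ?thesis using A True
        by (intro that[of d]) (auto simp: inN mem2 not_le dest!: spec)
    next
      case False
      then have *: "(Q *v x) $ 1 = l $ 1" using face by simp
      then have "(Q *v F x) $ 1 < 0" using F1(2)[OF x] by (simp add: QP)
      from has_real_derivative_neg_dec_right[OF D this]
      obtain d where "d > 0" "\<forall>h>0. 0 + h \<in> {-\<delta>1..\<delta>2} \<longrightarrow> h < d \<longrightarrow> (Q *v \<sigma> 0) $ 1 > (Q *v \<sigma> (0 + h)) $ 1"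
        by blast
      then show ?thesis using A *
        by (intro that[of d]) (auto simp: inN mem2 not_le dest!: spec)
    qed
    show "\<exists>\<epsilon>1 \<epsilon>2. 0 \<le> \<epsilon>1 \<and> \<epsilon>1 \<le> \<delta>1 \<and> 0 < \<epsilon>2 \<and> \<epsilon>2 \<le> \<delta>2 \<and>
           (\<forall>t. 0 < t \<and> t \<le> \<epsilon>2 \<longrightarrow> \<sigma> t \<notin> N) \<and>
           (\<forall>t. -\<epsilon>1 \<le> t \<and> t < 0 \<longrightarrow> \<sigma> t \<notin> frontier N)"
      \<comment> \<open>The choice 0 for \<open>\<epsilon>1\<close> empties the backward condition;
        halving \<open>d\<close> keeps the time strictly below \<open>d\<close>.\<close>
      using d A by (intro exI[of _ 0] exI[of _ "min \<delta>2 (d/2)"]) auto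
  qed
  have entrance: "entrance_point F N x"
    if x: "Q *v x \<in> cbox l u" and x1: "l $ 1 < (Q *v x) $ 1" "(Q *v x) $ 1 < u $ 1"
      and face: "(Q *v x) $ 2 = u $ 2 \<or> (Q *v x) $ 2 = l $ 2" for x
    unfolding entrance_point_def
  proof (intro conjI allI impI)
    show "x \<in> frontier N" using x face by (auto simp: front mem2)
    fix \<delta>1 \<delta>2 \<sigma>
    assume A: "\<delta>1 \<ge> 0 \<and> \<delta>2 > 0 \<and> solution_on F {-\<delta>1..\<delta>2} \<sigma> \<and> \<sigma> 0 = x"
    then have D: "((\<lambda>t. (Q *v \<sigma> t) $ i) has_real_derivative (Q *v F x) $ i) (at 0 within {-\<delta>1..\<delta>2})" for i
      using deriv[of "{-\<delta>1..\<delta>2}" \<sigma> 0 i] by auto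
    define W where "W i t = (Q *v \<sigma> t) $ i" for i t
    have W0: "W i 0 = (Q *v x) $ i" for i using A by (simp add: W_def)
    have near: "\<exists>d>0. \<forall>t. t > 0 \<longrightarrow> t \<le> \<delta>2 \<longrightarrow> t < d \<longrightarrow> \<bar>W i t - W i 0\<bar> < e" if "e > 0" for i e
    proof -
      have "continuous (at 0 within {-\<delta>1..\<delta>2}) (W i)"
        unfolding W_def using D by (rule DERIV_continuous)
      from this[unfolded continuous_within_eps_delta, rule_format, OF that]
      show ?thesis using A by (force simp: dist_real_def)
    qed
    \<comment> \<open>Three time bounds are combined: the first coordinate keeps away from the exit
      edges, the second moves by less than the edge-to-edge distance, hence stays short of the
      opposite edge, and the sign of its derivative moves it off its own edge.\<close>
    obtain d1 where d1: "d1 > 0" "\<And>t. t > 0 \<Longrightarrow> t \<le> \<delta>2 \<Longrightarrow> t < d1 \<Longrightarrow> l $ 1 < W 1 t \<and> W 1 t < u $ 1"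
      using near[of "min (W 1 0 - l $ 1) (u $ 1 - W 1 0)" 1] x1 by (force simp: W0)
    obtain d2 where d2: "d2 > 0" "\<And>t. t > 0 \<Longrightarrow> t \<le> \<delta>2 \<Longrightarrow> t < d2 \<Longrightarrow> \<bar>W 2 t - W 2 0\<bar> < u $ 2 - l $ 2"
      using near[of "u $ 2 - l $ 2" 2] lu by force
    obtain d where d: "d > 0" "\<And>t. t > 0 \<Longrightarrow> t \<le> \<delta>2 \<Longrightarrow> t < d \<Longrightarrow> \<sigma> t \<in> interior N"
    proof (cases "(Q *v x) $ 2 = u $ 2")
      case True
      then have "(Q *v F x) $ 2 < 0" using F2(1)[OF x] by (simp add: QP)
      from has_real_derivative_neg_dec_right[OF D this]
      obtain d where d: "d > 0" "\<forall>h>0. 0 + h \<in> {-\<delta>1..\<delta>2} \<longrightarrow> h < d \<longrightarrow> (Q *v \<sigma> 0) $ 2 > (Q *v \<sigma> (0 + h)) $ 2"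
        by blast
      show ?thesis
      proof
        show "min d (min d1 d2) > 0" using d d1 d2 by auto
        fix t assume t: "t > 0" "t \<le> \<delta>2" "t < min d (min d1 d2)"
        then have "W 2 t < W 2 0" using d(2) A by (auto simp: W_def)
        then show "\<sigma> t \<in> interior N"
          using d1(2)[of t] d2(2)[of t] t True
          by (auto simp: inI mem2 W0 W_def[symmetric])
      qed
    next
      case False
      then have *: "(Q *v x) $ 2 = l $ 2" using face by simp
      then have "(Q *v F x) $ 2 > 0" using F2(2)[OF x] by (simp add: QP)
      from has_real_derivative_pos_inc_right[OF D this]
      obtain d where d: "d > 0" "\<forall>h>0. 0 + h \<in> {-\<delta>1..\<delta>2} \<longrightarrow> h < d \<longrightarrow> (Q *v \<sigma> 0) $ 2 < (Q *v \<sigma> (0 + h)) $ 2"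
        by blast
      show ?thesis
      proof
        show "min d (min d1 d2) > 0" using d d1 d2 by auto
        fix t assume t: "t > 0" "t \<le> \<delta>2" "t < min d (min d1 d2)"
        then have "W 2 t > W 2 0" using d(2) A by (auto simp: W_def)
        then show "\<sigma> t \<in> interior N"
          using d1(2)[of t] d2(2)[of t] t *
          by (auto simp: inI mem2 W0 W_def[symmetric])
      qed
    qed
    show "\<exists>\<epsilon>1 \<epsilon>2. 0 \<le> \<epsilon>1 \<and> \<epsilon>1 \<le> \<delta>1 \<and> 0 < \<epsilon>2 \<and> \<epsilon>2 \<le> \<delta>2 \<and>
           (\<forall>t. 0 < t \<and> t \<le> \<epsilon>2 \<longrightarrow> \<sigma> t \<in> interior N) \<and>
           (\<forall>t. -\<epsilon>1 \<le> t \<and> t < 0 \<longrightarrow> \<sigma> t \<notin> N)"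
      using d A by (intro exI[of _ 0] exI[of _ "min \<delta>2 (d/2)"]) auto
  qed
  have not_both: "\<not> (exit_point F N x \<and> entrance_point F N x)" for x
  proof
    assume E: "exit_point F N x \<and> entrance_point F N x"
    \<comment> \<open>One forward solution from \<open>x\<close> refutes the conjunction: at the
      same small time it would be outside \<open>N\<close> and in its interior. The left end -0
      matches \<open>\<delta>1 = 0\<close>.\<close>
    obtain \<delta> \<sigma> where s: "\<delta> > 0" "solution_on F {-0..\<delta>} \<sigma>" "\<sigma> 0 = x" using ex[of x] by auto
    obtain e1 where e1: "e1 > 0" "e1 \<le> \<delta>" "\<And>t. 0 < t \<Longrightarrow> t \<le> e1 \<Longrightarrow> \<sigma> t \<notin> N"
      using E s unfolding exit_point_def by (metis order_refl)
    obtain e2 where e2: "e2 > 0" "e2 \<le> \<delta>" "\<And>t. 0 < t \<Longrightarrow> t \<le> e2 \<Longrightarrow> \<sigma> t \<in> interior N"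
      using E s unfolding entrance_point_def by (metis order_refl)
    have "\<sigma> (min e1 e2) \<notin> N" "\<sigma> (min e1 e2) \<in> interior N" using e1 e2 by auto
    then show False using interior_subset by blast
  qed
  have cases: "exit_point F N x \<or> entrance_point F N x" if "x \<in> frontier N" for x
  proof -
    have y: "Q *v x \<in> cbox l u" "Q *v x \<notin> box l u" using that front by auto
    then show ?thesis
      using exit[OF y(1)] entrance[OF y(1)] by (force simp: mem2)
  qed
  have exit_iff: "exit_point F N x \<longleftrightarrow>
      Q *v x \<in> cbox l u \<and> ((Q *v x) $ 1 = u $ 1 \<or> (Q *v x) $ 1 = l $ 1)" for x
  proof
    assume e: "exit_point F N x"
    then have y: "Q *v x \<in> cbox l u" "Q *v x \<notin> box l u"
      using front by (auto simp: exit_point_def)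
    then show "Q *v x \<in> cbox l u \<and> ((Q *v x) $ 1 = u $ 1 \<or> (Q *v x) $ 1 = l $ 1)"
      using entrance[OF y(1)] not_both[of x] e by (force simp: mem2)
  qed (use exit in auto)
  have "closed {x. exit_point F N x}"
  proof -
    have "{x. exit_point F N x} = N \<inter> {x. (Q *v x) $ 1 = u $ 1 \<or> (Q *v x) $ 1 = l $ 1}"
      by (auto simp: exit_iff inN)
    moreover have "closed {x. (Q *v x) $ 1 = u $ 1 \<or> (Q *v x) $ 1 = l $ 1}"
      by (intro closed_Collect_disj closed_Collect_eq continuous_intros
          matrix_vector_mult_linear_continuous_on)
    ultimately show ?thesis using compN by (simp add: closed_Int compact_imp_closed)
  qed
  moreover have "exit_point F N x \<or> entrance_point F N x \<Longrightarrow> x \<in> frontier N" for x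
    by (auto simp: exit_point_def entrance_point_def)
  ultimately show ?thesis
    unfolding isolating_block_def N_def[symmetric]
    using compN cases by (intro conjI closed_subset) blast+
qed

section \<open>Polynomial enclosure of the weight\<close>

text \<open>
  The hypotheses on \<open>c0, \<dots>, c7\<close> are the Bernstein coefficients of degree \<open>7\<close> on \<open>[0,1]\<close>,
  without their common positive denominators.
\<close>

lemma bernstein_nonneg:
  fixes t :: real
  assumes t: "0 \<le> t" "t \<le> 1"
    and c: "c0 \<ge> 0" "7*c0 + c1 \<ge> 0" "21*c0 + 6*c1 + c2 \<ge> 0" "35*c0 + 15*c1 + 5*c2 + c3 \<ge> 0"
      "35*c0 + 20*c1 + 10*c2 + 4*c3 + c4 \<ge> 0" "21*c0 + 15*c1 + 10*c2 + 6*c3 + 3*c4 + c5 \<ge> 0"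
      "7*c0 + 6*c1 + 5*c2 + 4*c3 + 3*c4 + 2*c5 + c6 \<ge> 0"
      "c0 + c1 + c2 + c3 + c4 + c5 + c6 + c7 \<ge> 0"
  shows "c0 + c1*t + c2*t^2 + c3*t^3 + c4*t^4 + c5*t^5 + c6*t^6 + c7*t^7 \<ge> 0"
proof -
  define s where "s = 1 - t"
  have s: "s \<ge> 0" "s + t = 1" using t by (simp_all add: s_def)
  \<comment> \<open>Each monomial is multiplied by a power of s + t = 1, which makes all terms
    homogeneous of degree 7.\<close>
  have "c0 + c1*t + c2*t^2 + c3*t^3 + c4*t^4 + c5*t^5 + c6*t^6 + c7*t^7 =
      c0*(s+t)^7 + c1*t*(s+t)^6 + c2*t^2*(s+t)^5 + c3*t^3*(s+t)^4 + c4*t^4*(s+t)^3 +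
      c5*t^5*(s+t)^2 + c6*t^6*(s+t) + c7*t^7"
    by (simp add: s)
  also have "\<dots> = c0 * s^7 + (7*c0 + c1) * (s^6*t) + (21*c0 + 6*c1 + c2) * (s^5*t^2) +
      (35*c0 + 15*c1 + 5*c2 + c3) * (s^4*t^3) + (35*c0 + 20*c1 + 10*c2 + 4*c3 + c4) * (s^3*t^4) +
      (21*c0 + 15*c1 + 10*c2 + 6*c3 + 3*c4 + c5) * (s^2*t^5) +
      (7*c0 + 6*c1 + 5*c2 + 4*c3 + 3*c4 + 2*c5 + c6) * (s*t^6) +
      (c0 + c1 + c2 + c3 + c4 + c5 + c6 + c7) * t^7"
    by algebra
  also have "\<dots> \<ge> 0"
  proof -
    have nonneg: "b0 * s^7 + b1 * (s^6*t) + b2 * (s^5*t^2) + b3 * (s^4*t^3) + b4 * (s^3*t^4) +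
        b5 * (s^2*t^5) + b6 * (s*t^6) + b7 * t^7 \<ge> 0"
      if "b0 \<ge> 0" "b1 \<ge> 0" "b2 \<ge> 0" "b3 \<ge> 0" "b4 \<ge> 0" "b5 \<ge> 0" "b6 \<ge> 0" "b7 \<ge> 0"
      for b0 b1 b2 b3 b4 b5 b6 b7
      using that s t by (intro add_nonneg_nonneg mult_nonneg_nonneg) auto
    show ?thesis by (rule nonneg) (fact c)+
  qed
  finally show ?thesis .
qed

text \<open>Squaring turns a quadratic majorant of 1 / sqrt ((1 + y) (1 - k y^2)) into a polynomial
  inequality of degree 7, with equality at y = 0; k = 0.3808 is the worst case. On all of [0,1] the
  Bernstein coefficient of s^4 t^3 would be negative, hence the halving, each half being rescaled to
  the unit interval.\<close>

lemma weight_upper_bound: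
  fixes y k :: real
  assumes y: "0 \<le> y" "y \<le> 1" and k: "k \<le> 0.3808"
  shows "1 \<le> (1 - 0.46*y + 0.36*y^2)^2 * ((1 + y) * (1 - k*y^2))"
proof -
  have "0 \<le> (1 - 0.46*y + 0.36*y^2)^2 * ((1 + y) * (1 - 0.3808*y^2)) - 1"
  proof (cases "y \<le> 1/2")
    case True
    have "0 \<le> 0 + 1/25*(2*y) + -(923/10000)*(2*y)^2 + 35621/500000*(2*y)^3 + -(160951/12500000)*(2*y)^4
      + -(77369/25000000)*(2*y)^5 + 7497/6250000*(2*y)^6 + -(9639/25000000)*(2*y)^7" (is "_ \<le> ?q")
      by (rule bernstein_nonneg) (use y True in simp_all)
    also have "?q = (1 - 0.46*y + 0.36*y^2)^2 * ((1 + y) * (1 - 0.3808*y^2)) - 1"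
      by (simp add: power_numeral_reduce field_simps)
    finally show ?thesis .
  next
    case False
    define t where "t = 2 - 2*y"
    have yt: "y = 1 - t/2" by (simp add: t_def field_simps)
    have "0 \<le> 97/31250 + 47709/625000*t + -(301041/1562500)*t^2 + 2244343/12500000*t^3 + -(62351/781250)*t^4
      + 527189/25000000*t^5 + -(52479/12500000)*t^6 + 9639/25000000*t^7" (is "_ \<le> ?q")
      by (rule bernstein_nonneg) (use y False in \<open>simp_all add: t_def\<close>)
    also have "?q = (1 - 0.46*y + 0.36*y^2)^2 * ((1 + y) * (1 - 0.3808*y^2)) - 1"
      unfolding yt by (simp add: power_numeral_reduce field_simps)
    finally show ?thesis .
  qed
  also have "\<dots> \<le> (1 - 0.46*y + 0.36*y^2)^2 * ((1 + y) * (1 - k*y^2)) - 1"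
    using y k by (intro diff_right_mono mult_left_mono diff_left_mono mult_right_mono) auto
  finally show ?thesis by simp
qed

text \<open>The quadratic is now a minorant, and k = 0.3807 is the worst case. The weight starts at
  1 with slope -1/2, below -0.46, so a minorant with slope -0.46 at 0 must start below 1; hence
  0.996. Without halving, the coefficient of s^6 t would be negative.\<close>

lemma weight_lower_bound:
  fixes y k :: real
  assumes y: "0 \<le> y" "y \<le> 1" and k: "0.3807 \<le> k"
  shows "(0.996 - 0.46*y + 0.355*y^2)^2 * ((1 + y) * (1 - k*y^2)) \<le> 1"
proof -
  have "(0.996 - 0.46*y + 0.355*y^2)^2 * ((1 + y) * (1 - k*y^2)) \<le>
      (0.996 - 0.46*y + 0.355*y^2)^2 * ((1 + y) * (1 - 0.3807*y^2))"
    using y k by (intro mult_left_mono diff_left_mono mult_right_mono) auto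
  moreover have "0 \<le> 1 - (0.996 - 0.46*y + 0.355*y^2)^2 * ((1 + y) * (1 - 0.3807*y^2))"
  proof (cases "y \<le> 1/2")
    case True
    have "0 \<le> 499/62500 + -(4731/125000)*(2*y) + 234512807/2500000000*(2*y)^2
      + -(352089083/5000000000)*(2*y)^3 + 50375977/4000000000*(2*y)^4
      + 12426289/4000000000*(2*y)^5 + -(30543561/25600000000)*(2*y)^6
      + 19191087/51200000000*(2*y)^7" (is "_ \<le> ?q")
      by (rule bernstein_nonneg) (use y True in simp_all)
    also have "?q = 1 - (0.996 - 0.46*y + 0.355*y^2)^2 * ((1 + y) * (1 - 0.3807*y^2))"
      by (simp add: power_numeral_reduce field_simps)
    finally show ?thesis .
  next
    case False
    define t where "t = 2 - 2*y"
    have yt: "y = 1 - t/2" by (simp add: t_def field_simps)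
    have "0 \<le> 83494967/5000000000 + -(330950367/4000000000)*t + 1876169977/10000000000*t^2
      + -(13888182817/80000000000)*t^3 + 1232392043/16000000000*t^4
      + -(1297577929/64000000000)*t^5 + 810891/200000000*t^6 + -(19191087/51200000000)*t^7" (is "_ \<le> ?q")
      by (rule bernstein_nonneg) (use y False in \<open>simp_all add: t_def\<close>)
    also have "?q = 1 - (0.996 - 0.46*y + 0.355*y^2)^2 * ((1 + y) * (1 - 0.3807*y^2))"
      unfolding yt by (simp add: power_numeral_reduce field_simps)
    finally show ?thesis .
  qed
  ultimately show ?thesis by linarith
qed

section \<open>The explicit pulse\<close>

text \<open>With w = 1/\<phi> the zero energy level of (D) at speed 0 reads w'^2 = (3/10) w^2 -
  (13/15) w + 1/2, which (13 + sqrt 34 cosh (sqrt (3/10) z)) / 9 solves. The crest value 9 / (13 +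
  sqrt 34) equals (13 - sqrt 34) / 15, the smaller root of 15 x^2 - 26 x + 9.\<close>

definition pulse :: "real \<Rightarrow> real" where
  "pulse z = 9 / (13 + sqrt 34 * cosh (sqrt (3/10) * z))"

definition pulse_slope :: "real \<Rightarrow> real" where
  "pulse_slope z = - 9 * sqrt 34 * sqrt (3/10) * sinh (sqrt (3/10) * z) /
     (13 + sqrt 34 * cosh (sqrt (3/10) * z))\<^sup>2"

lemma pulse_denom_pos: "13 + sqrt 34 * cosh (x :: real) > 0"
  by (intro add_pos_pos mult_pos_pos) auto

lemma sqrt_34_bounds: "5.8309 < sqrt 34" "sqrt 34 < 5.831"
  by (rule real_less_rsqrt real_less_lsqrt; simp add: power2_eq_square)+

lemma sqrt_3_10_bounds: "0.5477 < sqrt (3/10)" "sqrt (3/10) < 0.54773"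
  by (rule real_less_rsqrt real_less_lsqrt; simp add: power2_eq_square)+

lemma pulse_pos: "pulse z > 0"
  using pulse_denom_pos by (simp add: pulse_def)

lemma pulse_minus [simp]: "pulse (- z) = pulse z"
  by (simp add: pulse_def)

lemma pulse_le: "pulse z \<le> 9 / (13 + sqrt 34)"
  unfolding pulse_def
  by (intro divide_left_mono add_left_mono mult_pos_pos pulse_denom_pos)
    (auto simp: add_pos_pos cosh_real_ge_1 mult_le_cancel_left1)

lemma pulse_less_1: "pulse z < 1"
proof -
  have "9 / (13 + sqrt 34) < 1" using sqrt_34_bounds by simp
  then show ?thesis using pulse_le[of z] by linarith
qed

lemma DERIV_pulse: "(pulse has_real_derivative pulse_slope z) (at z)"
  unfolding pulse_def[abs_def] pulse_slope_def
  using pulse_denom_pos[of "sqrt (3/10) * z"]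
  by (auto intro!: derivative_eq_intros simp: power2_eq_square)

lemma DERIV_pulse_slope:
  "(pulse_slope has_real_derivative - pulse z * (1 - pulse z) * (pulse z - 0.3)) (at z)"
proof -
  define r s where "r = sqrt 34" and "s = sqrt (3/10)"
  have rs: "r\<^sup>2 = 34" "s\<^sup>2 = 3/10" by (simp_all add: r_def s_def)
  define S where "S = sinh (s * z)"
  define D where "D = 13 + r * cosh (s * z)"
  have D: "D > 0" using pulse_denom_pos by (simp add: D_def r_def)
  \<comment> \<open>Since 135 = 13^2 - 34, the hyperbolic identity removes sinh; as the pulse is 9 /
    D, all that remains is rational in \<open>D\<close>.\<close>
  have S: "r\<^sup>2 * S\<^sup>2 = D\<^sup>2 - 26 * D + 135"
    unfolding S_def D_def using cosh_square_eq[of "s * z"] rs(1)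
    by (simp add: power2_sum power_mult_distrib algebra_simps)
  have "(pulse_slope has_real_derivative
      ((- 9 * r * s * (cosh (s * z) * s)) * D\<^sup>2 - (- 9 * r * s * S) * (2 * D * (r * (S * s)))) / (D\<^sup>2 * D\<^sup>2)) (at z)"
    unfolding pulse_slope_def[abs_def] r_def[symmetric] s_def[symmetric]
  proof (subst D_def, subst D_def, subst D_def, subst D_def, subst S_def, rule DERIV_divide)
    show "((\<lambda>z. - 9 * r * s * sinh (s * z)) has_real_derivative - 9 * r * s * (cosh (s * z) * s)) (at z)"
      by (auto intro!: derivative_eq_intros)
    show "((\<lambda>z. (13 + r * cosh (s * z))\<^sup>2) has_real_derivative
        2 * (13 + r * cosh (s * z)) * (r * (S * s))) (at z)"
      by (auto intro!: derivative_eq_intros simp: S_def)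
    show "(13 + r * cosh (s * z))\<^sup>2 \<noteq> 0" using D by (simp add: D_def)
  qed
  also have "(- 9 * r * s * (cosh (s * z) * s)) * D\<^sup>2 - (- 9 * r * s * S) * (2 * D * (r * (S * s)))
      = - 9 * s\<^sup>2 * (D - 13) * D\<^sup>2 + 18 * s\<^sup>2 * D * (r\<^sup>2 * S\<^sup>2)"
    by (simp add: D_def power2_eq_square algebra_simps)
  also have "\<dots> / (D\<^sup>2 * D\<^sup>2) = - (9/D) * (1 - 9/D) * (9/D - 0.3)"
    unfolding S unfolding rs using D
    by (simp add: divide_simps) (simp add: power_numeral_reduce algebra_simps)
  also have "9 / D = pulse z" by (simp add: pulse_def D_def r_def s_def)
  finally show ?thesis .
qed

text \<open>This rests on |sinh| \<le> cosh and sqrt (3/10) \<le> 1. It lets the slope inherit every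
  zero limit of the pulse.\<close>

lemma abs_pulse_slope_le: "\<bar>pulse_slope z\<bar> \<le> pulse z"
proof -
  define r s where "r = sqrt 34" and "s = sqrt (3/10)"
  define S C where "S = sinh (s * z)" and "C = cosh (s * z)"
  have r: "r > 0" and s: "s > 0" "s \<le> 1" using sqrt_3_10_bounds by (auto simp: r_def s_def)
  have "\<bar>S\<bar> \<le> C" unfolding S_def C_def
    by (metis abs_of_nonneg cosh_real_abs cosh_real_nonneg less_imp_le sinh_less_cosh_real sinh_real_abs)
  then have "s * (r * \<bar>S\<bar>) \<le> 1 * (r * C)"
    using r s by (intro mult_mono) auto
  then have le: "r * s * \<bar>S\<bar> \<le> 13 + r * C" by (simp add: mult_ac)
  define D where "D = 13 + r * C"
  have D: "D > 0" using pulse_denom_pos by (simp add: D_def r_def C_def)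
  have "\<bar>pulse_slope z\<bar> = 9 * (r * s * \<bar>S\<bar>) / D\<^sup>2"
    using r s by (simp add: pulse_slope_def S_def C_def D_def r_def s_def abs_mult)
  also have "\<dots> \<le> 9 * D / D\<^sup>2"
    using le by (intro divide_right_mono mult_left_mono) (auto simp: D_def)
  also have "\<dots> = 9 / D"
    using D by (simp add: power2_eq_square)
  also have "\<dots> = pulse z" by (simp add: pulse_def r_def C_def s_def D_def)
  finally show ?thesis .
qed

lemma pulse_at_top: "(pulse \<longlongrightarrow> 0) at_top"
proof -
  have "filterlim (\<lambda>z. sqrt (3/10) * z) at_top at_top"
    by (intro filterlim_tendsto_pos_mult_at_top[OF tendsto_const]) (auto simp: filterlim_ident)
  then have "filterlim (\<lambda>z. cosh (sqrt (3/10) * z)) at_top at_top"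
    by (rule filterlim_compose[OF cosh_real_at_top])
  then have "filterlim (\<lambda>z. 13 + sqrt 34 * cosh (sqrt (3/10) * z)) at_top at_top"
    by (intro filterlim_tendsto_add_at_top[OF tendsto_const]
        filterlim_tendsto_pos_mult_at_top[OF tendsto_const]) auto
  then show ?thesis
    unfolding pulse_def[abs_def]
    by (intro tendsto_divide_0[OF tendsto_const] filterlim_at_top_imp_at_infinity)
qed

lemma pulse_at_bot: "(pulse \<longlongrightarrow> 0) at_bot"
  using pulse_at_top by (simp add: filterlim_at_bot_mirror)

lemma pulse_slope_tendsto_0: "(pulse \<longlongrightarrow> 0) F \<Longrightarrow> (pulse_slope \<longlongrightarrow> 0) F"
  using abs_pulse_slope_le by (intro Lim_null_comparison[of pulse_slope pulse]) auto

section \<open>Trigonometric substitution and enclosure of the half-length\<close>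

definition sin_poly_primitive :: "real \<Rightarrow> real \<Rightarrow> real \<Rightarrow> real \<Rightarrow> real" where
  "sin_poly_primitive c0 c1 c2 \<theta> =
     (let e2 = (c1 + 5/6 * c2) / 4; e1 = (c0 + 3 * e2) / 2
      in e1 * (\<theta> - sin \<theta> * cos \<theta>) - e2 * (sin \<theta> ^ 3 * cos \<theta>) - c2 / 6 * (sin \<theta> ^ 5 * cos \<theta>))"

text \<open>The coefficients come from (sin^5 cos)' = 5 sin^4 - 6 sin^6, (sin^3 cos)' = 3 sin^2 - 4
  sin^4 and (\<theta> - sin cos)' = 2 sin^2, applied from the top degree down. At pi/2 the cosine
  terms vanish, so only \<open>e1 * pi / 2\<close> survives.\<close>

lemma DERIV_sin_poly_primitive:
  "(sin_poly_primitive c0 c1 c2 has_real_derivative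
     (sin \<theta>)\<^sup>2 * (c0 + c1 * (sin \<theta>)\<^sup>2 + c2 * ((sin \<theta>)\<^sup>2)\<^sup>2)) (at \<theta>)"
proof -
  define S where "S = sin \<theta>"
  define e2 where "e2 = (c1 + 5/6 * c2) / 4"
  define e1 where "e1 = (c0 + 3 * e2) / 2"
  have c: "cos \<theta> * cos \<theta> = 1 - S\<^sup>2" "cos \<theta> * (cos \<theta> * x) = (1 - S\<^sup>2) * x" for x
    using cos_squared_eq[of \<theta>] by (simp_all add: S_def power2_eq_square flip: mult.assoc)
  have "(sin_poly_primitive c0 c1 c2 has_real_derivative
      e1 * (1 - (1 - S\<^sup>2 - S * S)) - e2 * (3 * S\<^sup>2 * (1 - S\<^sup>2) - S^3 * S)
      - c2/6 * (5 * S^4 * (1 - S\<^sup>2) - S^5 * S)) (at \<theta>)"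
    unfolding sin_poly_primitive_def[abs_def] Let_def e2_def[symmetric] e1_def[symmetric]
    by (auto intro!: derivative_eq_intros simp: S_def[symmetric] c mult_ac)
  also have "e1 * (1 - (1 - S\<^sup>2 - S * S)) - e2 * (3 * S\<^sup>2 * (1 - S\<^sup>2) - S^3 * S)
      - c2/6 * (5 * S^4 * (1 - S\<^sup>2) - S^5 * S) = S\<^sup>2 * (c0 + c1 * S\<^sup>2 + c2 * (S\<^sup>2)\<^sup>2)"
    by (simp add: e1_def e2_def field_simps power_numeral_reduce)
  finally show ?thesis by (simp add: S_def)
qed

lemma sin_poly_primitive_0 [simp]: "sin_poly_primitive c0 c1 c2 0 = 0"
  by (simp add: sin_poly_primitive_def Let_def)

text \<open>
  With \<open>v = (\<phi>/M)\<^bsup>1/4\<^esup>\<close>, \<open>M = max \<phi>\<close> and \<open>v = sin \<theta>\<close>, the energy identity for the pulse turns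
  \<open>\<phi>\<^bsup>3/4\<^esup> dz\<close> into a constant multiple of \<open>sin\<^sup>2 \<theta> / sqrt ((1 + sin\<^sup>2 \<theta>) (1 - k sin\<^sup>4 \<theta>)) d\<theta>\<close>.
\<close>

definition pulse_angle :: "real \<Rightarrow> real" where
  "pulse_angle z = arcsin (exp (ln (pulse z * (13 + sqrt 34) / 9) / 4))"

text \<open>Logarithmic differentiation gives v' / v = - sqrt (3/10) W / 4, and energy conservation
  gives W^2 = (1 - v^4) (1 - k v^4), where \<open>k\<close> is the ratio of the two positive roots
  of the energy polynomial. The arcsine divides by sqrt (1 - v^2), which cancels against 1 - v^4 and
  leaves \<open>R\<close>, bounded away from 0. At the crest v = 1 the arcsine is not
  differentiable, hence \<open>z > 0\<close>.\<close>

lemma pulse_angle: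
  fixes z :: real
  defines "v \<equiv> sin (pulse_angle z)" and "k \<equiv> (13 - sqrt 34) / (13 + sqrt 34)"
  assumes z: "z > 0"
  obtains R where "0 < v" "v < 1" "R \<ge> 0" "R\<^sup>2 = (1 + v\<^sup>2) * (1 - k * (v\<^sup>2)\<^sup>2)"
    "pulse z powr (3/4) = (9 / (13 + sqrt 34)) powr (3/4) * v ^ 3"
    "(pulse_angle has_real_derivative - (sqrt (3/10) / 4) * v * R) (at z)"
proof -
  define r s where "r = sqrt 34" and "s = sqrt (3/10)"
  have r: "r > 0" "r < 13" "r\<^sup>2 = 34" and s: "s > 0" using sqrt_34_bounds by (auto simp: r_def s_def)
  define V where "V z = exp (ln (pulse z * (13 + r) / 9) / 4)" for z
  define S C D where "S = sinh (s * z)" and "C = cosh (s * z)" and "D = 13 + r * C"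
  have S: "S > 0" using z s by (simp add: S_def)
  have C: "C > 1" using z s cosh_real_strict_mono[of 0 "s * z"] by (simp add: C_def)
  have D: "D > 0" using pulse_denom_pos by (simp add: D_def r_def C_def)
  have DC: "D > 13 + r" using r C by (simp add: D_def)
  have p: "pulse z = 9 / D" by (simp add: pulse_def D_def C_def r_def s_def)
  have V4: "V z ^ 4 = (13 + r) / D"
    using r D by (simp add: V_def p field_simps flip: exp_of_nat_mult)
  have V0: "V z > 0" by (simp add: V_def)
  have V1: "V z < 1"
  proof -
    have "V z ^ 4 < 1 ^ 4" unfolding V4 using DC D by simp
    then show ?thesis by (rule power_less_imp_less_base) simp
  qed
  have vV: "v = V z" 
  proof -
    have "sin (arcsin (V z)) = V z" using V0 V1 by (intro sin_arcsin) auto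
    then show ?thesis unfolding v_def pulse_angle_def V_def r_def .
  qed
  define W where "W = r * S / D"
  have W0: "W > 0" using r S D by (simp add: W_def)
  have W2: "W\<^sup>2 = (1 - v^4) * (1 - k * v^4)"
  proof -
    have "r\<^sup>2 * S\<^sup>2 = (D - (13 + r)) * (D - (13 - r))"
      using hyperbolic_pythagoras[of "s * z"]
      by (simp add: D_def S_def C_def power2_eq_square algebra_simps)
    then have "W\<^sup>2 = (D - (13 + r)) * (D - (13 - r)) / (D * D)"
      by (simp add: W_def power2_eq_square mult_ac)
    also have "\<dots> = (1 - (13 + r) / D) * (1 - (13 - r) / D)"
      using D by (simp add: divide_simps)
    also have "(13 + r) / D = v^4" by (simp add: vV V4)
    also have "(13 - r) / D = k * v^4" using r by (simp add: k_def vV V4 r_def[symmetric])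
    finally show ?thesis .
  qed
  define R where "R = W / sqrt (1 - v\<^sup>2)"
  have v: "0 < v" "v < 1" using V0 V1 by (simp_all add: vV)
  then have v2: "v\<^sup>2 < 1" by (simp add: power_less_one_iff abs_square_less_1)
  show thesis
  proof
    show "0 < v" "v < 1" by fact+
    show "R \<ge> 0" using W0 v2 by (simp add: R_def)
    have "R\<^sup>2 = (1 - (v\<^sup>2)\<^sup>2) * (1 - k * (v\<^sup>2)\<^sup>2) / (1 - v\<^sup>2)"
      using v2 W2 by (simp add: R_def power_divide)
    also have "\<dots> = (1 + v\<^sup>2) * (1 - k * (v\<^sup>2)\<^sup>2)"
      using v2 by (simp add: field_simps power2_eq_square)
    finally show "R\<^sup>2 = (1 + v\<^sup>2) * (1 - k * (v\<^sup>2)\<^sup>2)" .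
    have "pulse z = 9 / (13 + r) * v^4" using r D by (simp add: p vV V4 divide_simps)
    then have "pulse z powr (3/4) = (9 / (13 + r)) powr (3/4) * (v^4) powr (3/4)"
      using r v by (simp only:) (subst powr_mult; simp)
    also have "(v^4) powr (3/4) = v ^ 3"
    proof -
      have "v ^ 4 = v powr 4" using v by simp
      then have "(v ^ 4) powr (3/4) = v powr 3" by (simp only: powr_powr) simp
      then show ?thesis using v by simp
    qed
    finally show "pulse z powr (3/4) = (9 / (13 + sqrt 34)) powr (3/4) * v ^ 3"
      by (simp add: r_def)
    have "pulse_slope z = - 9 * r * s * S / D\<^sup>2"
      by (simp add: pulse_slope_def r_def s_def S_def C_def D_def)
    then have slope: "pulse_slope z / pulse z = - s * W"
      using D by (simp add: p W_def power2_eq_square)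
    have pos: "pulse z * (13 + r) / 9 > 0" using pulse_pos[of z] r by simp
    have "((\<lambda>z. ln (pulse z * (13 + r) / 9)) has_real_derivative
        1 / (pulse z * (13 + r) / 9) * (pulse_slope z * (13 + r) / 9)) (at z)"
      by (rule DERIV_chain2[where f=ln], rule DERIV_ln_divide[OF pos])
        (intro DERIV_cdivide DERIV_cmult_right DERIV_pulse)
    also have "1 / (pulse z * (13 + r) / 9) * (pulse_slope z * (13 + r) / 9) = pulse_slope z / pulse z"
      using pulse_pos[of z] r by (simp add: divide_simps)
    finally have "(V has_real_derivative V z * (pulse_slope z / pulse z / 4)) (at z)"
      unfolding V_def[abs_def] by (intro DERIV_chain2[where f=exp] DERIV_exp DERIV_cdivide)
    then have "((\<lambda>z. arcsin (V z)) has_real_derivative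
        inverse (sqrt (1 - (V z)\<^sup>2)) * (V z * (pulse_slope z / pulse z / 4))) (at z)"
      using V0 V1 by (intro DERIV_chain2[where f=arcsin] DERIV_arcsin) auto
    also have "(\<lambda>z. arcsin (V z)) = pulse_angle"
      by (simp add: fun_eq_iff V_def pulse_angle_def r_def)
    also have "inverse (sqrt (1 - (V z)\<^sup>2)) * (V z * (pulse_slope z / pulse z / 4)) =
        - (sqrt (3/10) / 4) * v * R"
      by (simp only: slope R_def vV s_def[symmetric] inverse_eq_divide times_divide_eq_left) simp
    finally show "(pulse_angle has_real_derivative - (sqrt (3/10) / 4) * v * R) (at z)" .
  qed
qed

lemma continuous_on_pulse_angle: "continuous_on S pulse_angle"
proof -
  have "continuous_on S pulse"
    using DERIV_pulse by (meson DERIV_isCont continuous_at_imp_continuous_on)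
  moreover have "exp (ln (pulse z * (13 + sqrt 34) / 9) / 4) \<in> {-1..1}" for z
  proof -
    have "pulse z * (13 + sqrt 34) / 9 \<le> 1" "pulse z * (13 + sqrt 34) / 9 > 0"
      using pulse_le[of z] pulse_pos[of z] by (auto simp: field_simps add_pos_pos)
    then show ?thesis by (auto intro: order_trans[of "-1" 0])
  qed
  ultimately show ?thesis
    unfolding pulse_angle_def[abs_def]
    using pulse_pos by (intro continuous_intros) (auto simp: less_imp_neq[symmetric] add_pos_pos)
qed

lemma pulse_angle_0: "pulse_angle 0 = pi / 2"
proof -
  have "pulse 0 * (13 + sqrt 34) / 9 = 1"
    using add_pos_pos[of 13 "sqrt 34"] by (simp add: pulse_def)
  then show ?thesis by (simp add: pulse_angle_def)
qed

lemma pulse_angle_at_top: "(pulse_angle \<longlongrightarrow> 0) at_top"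
proof -
  have pos: "pulse z * (13 + sqrt 34) / 9 > 0" for z
    using pulse_pos[of z] by (simp add: add_pos_pos)
  \<comment> \<open>The logarithm in \<open>pulse_angle\<close> diverges as the pulse tends to 0;
    the fourth root expresses the same function and is continuous there.\<close>
  have "((\<lambda>z. root 4 (pulse z * (13 + sqrt 34) / 9)) \<longlongrightarrow> root 4 (0 * (13 + sqrt 34) / 9)) at_top"
    by (intro tendsto_intros pulse_at_top) auto
  also have "(\<lambda>z. root 4 (pulse z * (13 + sqrt 34) / 9)) = (\<lambda>z. exp (ln (pulse z * (13 + sqrt 34) / 9) / 4))"
  proof
    fix z
    show "root 4 (pulse z * (13 + sqrt 34) / 9) = exp (ln (pulse z * (13 + sqrt 34) / 9) / 4)"
      using pos[of z] by (intro real_root_pos_unique) (auto simp flip: exp_of_nat_mult)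
  qed
  finally have "((\<lambda>z. arcsin (exp (ln (pulse z * (13 + sqrt 34) / 9) / 4))) \<longlongrightarrow> arcsin 0) at_top"
    by (intro isCont_tendsto_compose[OF isCont_arcsin]) auto
  then show ?thesis by (simp add: pulse_angle_def[abs_def])
qed

text \<open>With d = m v^3, the angle term falls at rate d times the quadratic times
  \<open>R\<close>, while \<open>X\<close> grows at rate d. Comparing the quadratic with 1 / R
  therefore decides whether the sum rises or falls; this takes the place of a change of variables in
  an integral.\<close>

lemma DERIV_antiderivative_plus_angle:
  fixes c0 c1 c2 :: real
  defines "m \<equiv> (9 / (13 + sqrt 34)) powr (3/4)" and "k \<equiv> (13 - sqrt 34) / (13 + sqrt 34)"
  defines "G \<equiv> sin_poly_primitive c0 c1 c2"
  assumes X: "(X has_real_derivative pulse z powr (3/4)) (at z)" and z: "z > 0"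
  obtains y R d where "0 < y" "y < 1" "R \<ge> 0" "R\<^sup>2 = (1 + y) * (1 - k * y\<^sup>2)" "d > 0"
    "((\<lambda>z. 4 * m / sqrt (3/10) * G (pulse_angle z) + X z) has_real_derivative
       d * (1 - (c0 + c1 * y + c2 * y\<^sup>2) * R)) (at z)"
proof -
  define v where "v = sin (pulse_angle z)"
  define s where "s = sqrt (3/10)"
  have s: "s > 0" by (simp add: s_def)
  have m: "m > 0" using add_pos_pos[of 13 "sqrt 34"] by (simp add: m_def)
  obtain R where v: "0 < v" "v < 1" and R: "R \<ge> 0" "R\<^sup>2 = (1 + v\<^sup>2) * (1 - k * (v\<^sup>2)\<^sup>2)"
    and p: "pulse z powr (3/4) = m * v ^ 3"
    and D: "(pulse_angle has_real_derivative - (s / 4) * v * R) (at z)"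
    unfolding v_def k_def m_def s_def by (rule pulse_angle[OF z])
  show thesis
  proof
    show "0 < v\<^sup>2" "v\<^sup>2 < 1" using v by (simp_all add: abs_square_less_1)
    show "R \<ge> 0" "R\<^sup>2 = (1 + v\<^sup>2) * (1 - k * (v\<^sup>2)\<^sup>2)" by fact+
    show "m * v ^ 3 > 0" using m v by simp
    have "((\<lambda>z. 4 * m / s * G (pulse_angle z) + X z) has_real_derivative
       4 * m / s * ((v\<^sup>2 * (c0 + c1 * v\<^sup>2 + c2 * (v\<^sup>2)\<^sup>2)) * (- (s / 4) * v * R)) + m * v ^ 3) (at z)"
      unfolding G_def v_def
      by (intro DERIV_add DERIV_cmult DERIV_chain2[where f="sin_poly_primitive c0 c1 c2"] DERIV_sin_poly_primitive
          D[unfolded v_def] X[unfolded p v_def])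
    also have "4 * m / s * ((v\<^sup>2 * (c0 + c1 * v\<^sup>2 + c2 * (v\<^sup>2)\<^sup>2)) * (- (s / 4) * v * R)) + m * v ^ 3
        = m * v^3 * (1 - (c0 + c1 * v\<^sup>2 + c2 * (v\<^sup>2)\<^sup>2) * R)"
      using s by (simp add: field_simps power_numeral_reduce)
    finally show "((\<lambda>z. 4 * m / sqrt (3/10) * G (pulse_angle z) + X z) has_real_derivative
       m * v^3 * (1 - (c0 + c1 * v\<^sup>2 + c2 * (v\<^sup>2)\<^sup>2) * R)) (at z)"
      by (simp add: s_def)
  qed
qed

lemma pulse_modulus_bounds: "0.3807 \<le> (13 - sqrt 34) / (13 + sqrt 34)" "(13 - sqrt 34) / (13 + sqrt 34) \<le> 0.3808"
  using sqrt_34_bounds by (simp_all add: field_simps)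

text \<open>Fourth powers clear the exponent: (M^(3/4))^4 = M^3, so rational bounds for sqrt 34
  suffice.\<close>

lemma pulse_scale_bounds:
  "0.5748 \<le> (9 / (13 + sqrt 34)) powr (3/4)" "(9 / (13 + sqrt 34)) powr (3/4) \<le> 0.5749"
proof -
  define M where "M = 9 / (13 + sqrt 34)"
  have M: "0.477934 \<le> M" "M \<le> 0.477938" "M > 0"
    using sqrt_34_bounds by (simp_all add: M_def field_simps)
  have "(M powr (3/4)) ^ 4 = M ^ 3"
  proof -
    have "(M powr (3/4)) ^ 4 = (M powr (3/4)) powr 4" using M by simp
    also have "\<dots> = M powr 3" by (simp only: powr_powr) simp
    finally show ?thesis using M by simp
  qed
  moreover have "M ^ 3 \<le> 0.477938 ^ 3" "0.477934 ^ 3 \<le> M ^ 3"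
    using M by (intro power_mono; simp)+
  ultimately have "(M powr (3/4)) ^ 4 \<le> 0.5749 ^ 4" "0.5748 ^ 4 \<le> (M powr (3/4)) ^ 4"
    by (simp_all add: field_simps)
  then show "0.5748 \<le> (9 / (13 + sqrt 34)) powr (3/4)" "(9 / (13 + sqrt 34)) powr (3/4) \<le> 0.5749"
    unfolding M_def by (auto dest: power_le_imp_le_base[rotated])
qed

lemma antiderivative_bounds:
  fixes X :: "real \<Rightarrow> real"
  defines "K \<equiv> 4 * (9 / (13 + sqrt 34)) powr (3/4) / sqrt (3/10)"
  assumes X: "\<And>z. (X has_real_derivative pulse z powr (3/4)) (at z)" and X0: "X 0 = 0"
  shows "z > 0 \<Longrightarrow> X z \<le> K * (sin_poly_primitive 1 (-0.46) 0.36 (pi/2) -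
      sin_poly_primitive 1 (-0.46) 0.36 (pulse_angle z))"
    and "z > 0 \<Longrightarrow> X z \<ge> K * (sin_poly_primitive 0.996 (-0.46) 0.355 (pi/2) -
      sin_poly_primitive 0.996 (-0.46) 0.355 (pulse_angle z))"
proof -
  have cont: "continuous_on {0..z} (\<lambda>z. K * sin_poly_primitive c0 c1 c2 (pulse_angle z) + X z)" for c0 c1 c2
  proof -
    have "continuous_on UNIV (sin_poly_primitive c0 c1 c2)" "continuous_on {0..z} X"
      using DERIV_sin_poly_primitive X by (meson DERIV_isCont continuous_at_imp_continuous_on)+
    then show ?thesis
      by (intro continuous_intros continuous_on_compose2[OF _ continuous_on_pulse_angle]) auto
  qed
  show "X z \<le> K * (sin_poly_primitive 1 (-0.46) 0.36 (pi/2) -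
      sin_poly_primitive 1 (-0.46) 0.36 (pulse_angle z))" if z: "z > 0"
  proof -
    let ?H = "\<lambda>z. K * sin_poly_primitive 1 (-0.46) 0.36 (pulse_angle z) + X z"
    have "?H z \<le> ?H 0"
    \<comment> \<open>The open-interval version of the monotonicity rule: at the left end, the
      crest, only continuity of the angle is available.\<close>
    proof (rule DERIV_nonpos_imp_decreasing_open[OF _ _ cont])
      fix t assume "0 < t" "t < z"
      note rule = DERIV_antiderivative_plus_angle[OF X this(1), of 1 "-0.46" "0.36", folded K_def]
      obtain y R d where y: "0 < y" "y < 1" "R \<ge> 0" "d > 0"
        and R: "R\<^sup>2 = (1 + y) * (1 - (13 - sqrt 34) / (13 + sqrt 34) * y\<^sup>2)"
        and D: "(?H has_real_derivative d * (1 - (1 + (-0.46) * y + 0.36 * y\<^sup>2) * R)) (at t)"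
        by (rule rule)
      \<comment> \<open>\<open>R\<close> is given by its square and its sign, so the comparison with
        1 is made between squares.\<close>
      have "1 \<le> ((1 - 0.46 * y + 0.36 * y\<^sup>2) * R)\<^sup>2"
        using weight_upper_bound[of y, OF _ _ pulse_modulus_bounds(2)] y
        by (simp add: power_mult_distrib R)
      then have "1\<^sup>2 \<le> ((1 - 0.46 * y + 0.36 * y\<^sup>2) * R)\<^sup>2" by simp
      moreover have "(1 - 0.46 * y + 0.36 * y\<^sup>2) * R \<ge> 0"
      proof (rule mult_nonneg_nonneg)
        show "0 \<le> 1 - 0.46 * y + 0.36 * y\<^sup>2" using y by (intro add_nonneg_nonneg) auto
      qed (use y in simp)
      ultimately have "1 \<le> (1 - 0.46 * y + 0.36 * y\<^sup>2) * R" by (rule power2_le_imp_le)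
      then have "d * (1 - (1 + (-0.46) * y + 0.36 * y\<^sup>2) * R) \<le> 0"
        using y by (intro mult_nonneg_nonpos) auto
      with D show "\<exists>y. (?H has_real_derivative y) (at t) \<and> y \<le> 0" by blast
    qed (use z in auto)
    then show ?thesis by (simp add: X0 pulse_angle_0 right_diff_distrib)
  qed
  show "X z \<ge> K * (sin_poly_primitive 0.996 (-0.46) 0.355 (pi/2) -
      sin_poly_primitive 0.996 (-0.46) 0.355 (pulse_angle z))" if z: "z > 0"
  proof -
    let ?H = "\<lambda>z. K * sin_poly_primitive 0.996 (-0.46) 0.355 (pulse_angle z) + X z"
    have "?H 0 \<le> ?H z"
    proof (rule DERIV_nonneg_imp_increasing_open[OF _ _ cont])
      fix t assume "0 < t" "t < z"
      note rule = DERIV_antiderivative_plus_angle[OF X this(1), of "0.996" "-0.46" "0.355", folded K_def]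
      obtain y R d where y: "0 < y" "y < 1" "R \<ge> 0" "d > 0"
        and R: "R\<^sup>2 = (1 + y) * (1 - (13 - sqrt 34) / (13 + sqrt 34) * y\<^sup>2)"
        and D: "(?H has_real_derivative d * (1 - (0.996 + (-0.46) * y + 0.355 * y\<^sup>2) * R)) (at t)"
        by (rule rule)
      have "((0.996 - 0.46 * y + 0.355 * y\<^sup>2) * R)\<^sup>2 \<le> 1"
        using weight_lower_bound[of y, OF _ _ pulse_modulus_bounds(1)] y
        by (simp add: power_mult_distrib R)
      then have "(0.996 - 0.46 * y + 0.355 * y\<^sup>2) * R \<le> 1"
        unfolding abs_square_le_1 by linarith
      then have "d * (1 - (0.996 + (-0.46) * y + 0.355 * y\<^sup>2) * R) \<ge> 0"
        using y by (intro mult_nonneg_nonneg) auto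
      with D show "\<exists>y. (?H has_real_derivative y) (at t) \<and> y \<ge> 0" by blast
    qed (use z in auto)
    then show ?thesis by (simp add: X0 pulse_angle_0 right_diff_distrib)
  qed
qed

lemma pulse_wave_variable:
  obtains X L where "\<And>z. (X has_real_derivative pulse z powr (3/4)) (at z)"
    "\<And>z. X (- z) = - X z" "(X \<longlongrightarrow> L) at_top" "2 * L \<in> {5.7503277707 .. 5.8115725019}"
proof -
  have contp: "isCont (\<lambda>z. pulse z powr (3/4)) z" for z
    using DERIV_pulse[THEN DERIV_isCont, of z] pulse_pos[of z] by (intro continuous_intros) auto
  obtain F where F: "\<And>z. (F has_real_derivative pulse z powr (3/4)) (at z)"
    using einterval_antiderivative[of "-\<infinity>" \<infinity> "\<lambda>z. pulse z powr (3/4)"] contp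
    by (auto simp: has_real_derivative_iff_has_vector_derivative)
  \<comment> \<open>The pulse is even, so antisymmetrizing an antiderivative keeps its derivative,
    normalizes it to 0 at 0 and makes the support symmetric.\<close>
  define X where "X z = (F z - F (- z)) / 2" for z
  have X: "(X has_real_derivative pulse z powr (3/4)) (at z)" for z
  proof -
    have "((\<lambda>z. F (- z)) has_real_derivative pulse (- z) powr (3/4) * (-1)) (at z)"
      by (rule DERIV_chain2[where f=F, OF F]) (auto intro!: derivative_eq_intros)
    then show ?thesis
      unfolding X_def[abs_def] by (auto intro!: derivative_eq_intros F)
  qed
  have X_odd: "X (- z) = - X z" for z by (simp add: X_def field_simps)
  have X0: "X 0 = 0" by (simp add: X_def)
  have X_mono: "X x \<le> X y" if "x \<le> y" for x y
    using that X by (intro DERIV_nonneg_imp_nondecreasing[of x y X]) (blast intro: powr_ge_zero)+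
  define K where "K = 4 * (9 / (13 + sqrt 34)) powr (3/4) / sqrt (3/10)"
  let ?U = "sin_poly_primitive 1 (-0.46) 0.36" and ?V = "sin_poly_primitive 0.996 (-0.46) 0.355"
  have lim: "((\<lambda>z. K * (sin_poly_primitive c0 c1 c2 (pi/2) - sin_poly_primitive c0 c1 c2 (pulse_angle z)))
      \<longlongrightarrow> K * sin_poly_primitive c0 c1 c2 (pi/2)) at_top" for c0 c1 c2
  proof -
    have "((\<lambda>z. sin_poly_primitive c0 c1 c2 (pulse_angle z)) \<longlongrightarrow> sin_poly_primitive c0 c1 c2 0) at_top"
      by (rule isCont_tendsto_compose[OF DERIV_isCont[OF DERIV_sin_poly_primitive] pulse_angle_at_top])
    then have "((\<lambda>z. K * (sin_poly_primitive c0 c1 c2 (pi/2) - sin_poly_primitive c0 c1 c2 (pulse_angle z)))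
      \<longlongrightarrow> K * (sin_poly_primitive c0 c1 c2 (pi/2) - sin_poly_primitive c0 c1 c2 0)) at_top"
      by (intro tendsto_intros)
    then show ?thesis by simp
  qed
  \<comment> \<open>The bound for positive z still contains the angle. Monotonicity of
    \<open>X\<close> extends it to every z, and letting the comparison point tend to infinity
    removes the angle term.\<close>
  have upper: "X z \<le> K * ?U (pi/2)" for z
  proof (rule tendsto_lowerbound[OF lim])
    show "\<forall>\<^sub>F x in at_top. X z \<le> K * (?U (pi/2) - ?U (pulse_angle x))"
      using eventually_gt_at_top[of "max 0 z"]
    proof eventually_elim
      case (elim x)
      then have "X z \<le> X x" by (intro X_mono) auto
      also have "\<dots> \<le> K * (?U (pi/2) - ?U (pulse_angle x))"
        unfolding K_def by (rule antiderivative_bounds(1)[OF X X0]) (use elim in auto)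
      finally show ?case .
    qed
  qed simp
  define L where "L = (SUP z. X z)"
  have bdd: "bdd_above (range X)" by (rule bdd_aboveI2) (rule upper)
  have X_le: "X z \<le> L" for z unfolding L_def using bdd by (rule cSUP_upper[rotated]) simp
  have L_upper: "L \<le> K * ?U (pi/2)" unfolding L_def using upper by (intro cSUP_least) auto
  have "(X \<longlongrightarrow> L) at_top"
  proof (rule increasing_tendsto)
    fix x assume "x < L"
    then obtain z where "x < X z" unfolding L_def using bdd by (auto simp: less_cSUP_iff)
    with X_mono show "\<forall>\<^sub>F n in at_top. x < X n"
      unfolding eventually_at_top_linorder by (meson less_le_trans)
  qed (use X_le in auto)
  moreover have L_lower: "K * ?V (pi/2) \<le> L"
  proof (rule tendsto_upperbound[OF lim])
    show "\<forall>\<^sub>F x in at_top. K * (?V (pi/2) - ?V (pulse_angle x)) \<le> L"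
      using eventually_gt_at_top[of 0]
    proof eventually_elim
      case (elim x)
      have "K * (?V (pi/2) - ?V (pulse_angle x)) \<le> X x"
        unfolding K_def by (rule antiderivative_bounds(2)[OF X X0]) (use elim in auto)
      with X_le[of x] show ?case by simp
    qed
  qed simp
  moreover have "2 * L \<in> {5.7503277707 .. 5.8115725019}"
  proof -
    have "K \<le> 4 * 0.5749 / 0.5477" unfolding K_def
      using pulse_scale_bounds sqrt_3_10_bounds by (intro frac_le mult_left_mono) auto
    \<comment> \<open>The exact values are 0.44 * pi / 2 here and 0.4364375 * pi / 2 for
      \<open>?V\<close>.\<close>
    moreover have "?U (pi/2) \<le> 0.69117" "?U (pi/2) \<ge> 0"
      using pi_approx by (simp_all add: sin_poly_primitive_def Let_def)
    ultimately have U: "K * ?U (pi/2) \<le> (4 * 0.5749 / 0.5477) * 0.69117"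
      by (intro mult_mono) auto
    have "K \<ge> 4 * 0.5748 / 0.54773" unfolding K_def
      using pulse_scale_bounds sqrt_3_10_bounds by (intro frac_le mult_left_mono) auto
    moreover have "?V (pi/2) \<ge> 0.68555"
      using pi_approx by (simp_all add: sin_poly_primitive_def Let_def)
    ultimately have "K * ?V (pi/2) \<ge> (4 * 0.5748 / 0.54773) * 0.68555"
      by (intro mult_mono) auto
    with U L_upper L_lower show ?thesis by simp
  qed
  ultimately show thesis using that[of X L] X X_odd by blast
qed

section \<open>The wave variable and stationary weak solutions\<close>

text \<open>\<open>X\<close> is a strictly increasing bijection from the line onto (-L, L). Its
  inverse is the desingularized variable as a function of the wave variable: for \<open>g\<close>
  the power 3/4 of the pulse, the derivative of \<open>z\<close> is the power -3/4.\<close>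

lemma odd_bounded_primitive_inverse:
  fixes X g :: "real \<Rightarrow> real"
  assumes X: "\<And>t. (X has_real_derivative g t) (at t)" and g: "\<And>t. g t > 0"
    and X_odd: "\<And>t. X (- t) = - X t" and lim: "(X \<longlongrightarrow> L) at_top"
  obtains z where "L > 0" "bij_betw z {-L<..<L} UNIV"
    "\<And>\<xi>. \<xi> \<in> {-L<..<L} \<Longrightarrow> (z has_real_derivative inverse (g (z \<xi>))) (at \<xi>)"
    "filterlim z at_top (at_left L)" "filterlim z at_bot (at_right (- L))"
proof -
  have mono: "X a < X b" if "a < b" for a b
    by (rule DERIV_pos_imp_increasing[OF that]) (use X g in blast)
  then have le: "X a < X b \<longleftrightarrow> a < b" "X a \<le> X b \<longleftrightarrow> a \<le> b" for a b
    by (metis less_asym' linorder_cases not_le order_le_less)+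
  have lt: "X t < L" for t
  proof -
    \<comment> \<open>Taken one unit further on, so that strict growth turns the weak bound by the
      limit into a strict one.\<close>
    have "X (t + 1) \<le> L"
    proof (rule tendsto_lowerbound[OF lim])
      show "\<forall>\<^sub>F x in at_top. X (t + 1) \<le> X x"
        using eventually_ge_at_top[of "t + 1"] by eventually_elim (simp add: le)
    qed simp
    then show ?thesis using mono[of t "t + 1"] by simp
  qed
  have gt: "- L < X t" for t using lt[of "- t"] by (simp add: X_odd)
  have inj: "inj X" by (rule injI) (metis le(2) order_antisym order_refl)
  have ex: "\<exists>b. \<xi> < X b" if "\<xi> < L" for \<xi>
    using order_tendstoD(1)[OF lim that] by (auto simp: eventually_at_top_linorder)
  have surj: "\<exists>t. X t = \<xi>" if \<xi>: "\<xi> \<in> {-L<..<L}" for \<xi>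
  proof -
    obtain a b where ab: "\<xi> < X b" "- \<xi> < X a" using ex[of \<xi>] ex[of "- \<xi>"] \<xi> by auto
    then have "X (- a) < X b" by (simp add: X_odd)
    then have "- a \<le> b" by (simp add: le)
    then show ?thesis
      using IVT'[of X "- a" \<xi> b] ab X
      by (metis X_odd continuous_at_imp_continuous_on DERIV_isCont less_imp_le minus_less_iff)
  qed
  define z where "z = inv X"
  have zX: "z (X t) = t" for t using inj by (simp add: z_def)
  have Xz: "X (z \<xi>) = \<xi>" if "\<xi> \<in> {-L<..<L}" for \<xi> using surj[OF that] zX by metis
  show thesis
  proof
    show "L > 0" using lt[of 0] X_odd[of 0] by simp
    show "bij_betw z {-L<..<L} UNIV"
      by (rule bij_betw_byWitness[where f' = X]) (use Xz zX lt gt in auto)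
    show "(z has_real_derivative inverse (g (z \<xi>))) (at \<xi>)" if \<xi>: "\<xi> \<in> {-L<..<L}" for \<xi>
    proof (rule DERIV_inverse_function[where f = X and a = "- L" and b = L])
      show "(X has_real_derivative g (z \<xi>)) (at (z \<xi>))" "g (z \<xi>) \<noteq> 0" using X g[of "z \<xi>"] by auto
      show "- L < \<xi>" "\<xi> < L" using \<xi> by auto
      show "X (z y) = y" if "- L < y" "y < L" for y using Xz that by auto
      have "isCont z (X (z \<xi>))"
        by (rule isCont_inverse_function[of 1]) (auto simp: zX intro: DERIV_isCont X)
      then show "isCont z \<xi>" using Xz[OF \<xi>] by simp
    qed
    show "filterlim z at_top (at_left L)"
      unfolding filterlim_at_top eventually_at_left_field
    proof
      fix Z
      have "Z \<le> z y" if "X Z < y" "y < L" for y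
        using that gt[of Z] Xz[of y] le(2)[of Z "z y"] by simp
      then show "\<exists>b<L. \<forall>y>b. y < L \<longrightarrow> Z \<le> z y" using lt[of Z] by blast
    qed
    show "filterlim z at_bot (at_right (- L))"
      unfolding filterlim_at_bot eventually_at_right_field
    proof
      fix Z
      have "z y \<le> Z" if "- L < y" "y < X Z" for y
        using that lt[of Z] Xz[of y] le(2)[of "z y" Z] by simp
      then show "\<exists>b>- L. \<forall>y>- L. y < b \<longrightarrow> z y \<le> Z" using gt[of Z] by blast
    qed
  qed
qed

text \<open>At the two edges the one-sided limits agree with the outer value 0. It serves both the
  profile and its flux.\<close>

lemma isCont_zero_extension:
  fixes h :: "real \<Rightarrow> real"
  assumes L: "L > 0" and cont: "\<And>\<xi>. \<xi> \<in> {-L<..<L} \<Longrightarrow> isCont h \<xi>"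
    and left: "(h \<longlongrightarrow> 0) (at_right (- L))" and right: "(h \<longlongrightarrow> 0) (at_left L)"
  shows "isCont (\<lambda>\<xi>. if \<xi> \<in> {-L<..<L} then h \<xi> else 0) \<xi>"
proof -
  let ?H = "\<lambda>\<xi>. if \<xi> \<in> {-L<..<L} then h \<xi> else 0"
  have out: "(?H \<longlongrightarrow> 0) F" if "\<forall>\<^sub>F x in F. x \<notin> {-L<..<L}" for F
    by (rule tendsto_eventually) (use that in eventually_elim, auto)
  have ins: "(?H \<longlongrightarrow> l) F" if "(h \<longlongrightarrow> l) F" "\<forall>\<^sub>F x in F. x \<in> {-L<..<L}" for F l
    by (rule Lim_transform_eventually[OF that(1)]) (use that(2) in eventually_elim, auto)
  consider "\<xi> \<in> {-L<..<L}" | "\<xi> = L" | "\<xi> = - L" | "\<xi> > L" | "\<xi> < - L" by force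
  then show ?thesis
  proof cases
    case 1
    then have "\<forall>\<^sub>F x in at \<xi>. x \<in> {-L<..<L}" by (intro eventually_at_in_open') auto
    with ins[of "h \<xi>" "at \<xi>"] cont[OF 1] 1 show ?thesis by (simp add: isCont_def)
  next
    case 2
    have "\<forall>\<^sub>F x in at_left L. x \<in> {-L<..<L}"
      using L by (auto simp: eventually_at_left_field intro: exI[of _ "- L"])
    moreover have "\<forall>\<^sub>F x in at_right L. x \<notin> {-L<..<L}"
      by (auto simp: eventually_at_right_field intro: exI[of _ "L + 1"])
    ultimately show ?thesis
      using ins[OF right] out[of "at_right L"] 2 unfolding isCont_def filterlim_at_split by simp
  next
    case 3
    have "\<forall>\<^sub>F x in at_right (- L). x \<in> {-L<..<L}"
      using L by (auto simp: eventually_at_right_field intro: exI[of _ L])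
    moreover have "\<forall>\<^sub>F x in at_left (- L). x \<notin> {-L<..<L}"
      by (auto simp: eventually_at_left_field intro: exI[of _ "- L - 1"])
    ultimately show ?thesis
      using ins[OF left] out[of "at_left (- L)"] 3 unfolding isCont_def filterlim_at_split by simp
  next
    case 4
    then have "\<forall>\<^sub>F x in at \<xi>. x \<in> {L<..}" by (intro eventually_at_in_open') auto
    then have "\<forall>\<^sub>F x in at \<xi>. x \<notin> {-L<..<L}" by eventually_elim auto
    with out[of "at \<xi>"] 4 show ?thesis by (simp add: isCont_def)
  next
    case 5
    then have "\<forall>\<^sub>F x in at \<xi>. x \<in> {..<-L}" by (intro eventually_at_in_open') auto
    then have "\<forall>\<^sub>F x in at \<xi>. x \<notin> {-L<..<L}" by eventually_elim auto
    with out[of "at \<xi>"] 5 show ?thesis by (simp add: isCont_def)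
  qed
qed

text \<open>At each fixed time, two integrations by parts in x move both derivatives off the test
  function. \<open>\<Psi>\<close> is the flux d (u^(m+1))_x; being continuous, it produces no jump
  at the exceptional points in \<open>S\<close>. What remains is the time derivative of the test
  function against the time-independent \<open>u\<close>, handled by exchanging the order of
  integration.\<close>

lemma stationary_weak_solution:
  fixes u \<Psi> f :: "real \<Rightarrow> real" and m :: real
  assumes m: "m + 1 > 0" and S: "finite S"
    and u: "continuous_on UNIV u" "\<And>x. 0 \<le> u x" "\<And>x. u x \<le> 1"
    and \<Psi>: "continuous_on UNIV \<Psi>"
    and flux: "\<And>x. x \<notin> S \<Longrightarrow> ((\<lambda>x. u x powr (m + 1)) has_real_derivative (m + 1) * \<Psi> x) (at x)"
    and source: "\<And>x. x \<notin> S \<Longrightarrow> (\<Psi> has_real_derivative - f (u x)) (at x)"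
  shows "weak_solution m f u (\<lambda>t. u)"
proof -
  define d where "d = 1 / (m + 1)"
  have d: "d * (m + 1) = 1" using m by (simp add: d_def)
  define w where "w x = u x powr (m + 1)" for x
  have w: "continuous_on A w" for A
    unfolding w_def by (intro continuous_on_powr' continuous_on_subset[OF u(1)] continuous_intros)
      (use u m in auto)
  have main: "integral {0..T} (\<lambda>t. integral {-r..r} (\<lambda>x.
               u x * \<psi>t t x + d * w x * \<psi>xx t x + f (u x) * \<psi> t x))
           = integral {-r..r} (\<lambda>x. u x * \<psi> T x - u x * \<psi> 0 x)
             + d * integral {0..T} (\<lambda>t. w r * \<psi>x t r - w (-r) * \<psi>x t (-r))"
    if rT: "r > 0" "T > 0" and C: "C21_strip T \<psi> \<psi>t \<psi>x \<psi>xx"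
      and bd: "\<And>t. t \<in> {0..T} \<Longrightarrow> \<psi> t r = 0 \<and> \<psi> t (-r) = 0"
    for r T \<psi> \<psi>t \<psi>x \<psi>xx
  proof -
    have cont: "continuous_on ({0..T} \<times> UNIV) (\<lambda>(t, x). \<psi>t t x)"
        "continuous_on ({0..T} \<times> UNIV) (\<lambda>(t, x). \<psi>x t x)"
      using C by (auto simp: C21_strip_def)
    have D: "((\<lambda>s. \<psi> s x) has_real_derivative \<psi>t t x) (at t within {0..T})"
        "((\<lambda>y. \<psi> t y) has_real_derivative \<psi>x t x) (at x)"
        "((\<lambda>y. \<psi>x t y) has_real_derivative \<psi>xx t x) (at x)" if "t \<in> {0..T}" for t x
      using C that by (auto simp: C21_strip_def)
    define b where "b t = w r * \<psi>x t r - w (-r) * \<psi>x t (-r)" for t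
    have space: "((\<lambda>x. d * w x * \<psi>xx t x + f (u x) * \<psi> t x) has_integral d * b t) {-r..r}"
      if t: "t \<in> {0..T}" for t
    proof -
      \<comment> \<open>In H' the two products of \<open>\<Psi>\<close> and \<open>\<psi>x\<close>
        cancel because d (m + 1) = 1. At the ends of [-r, r] the \<open>\<Psi>\<close> term drops
        out, the test function being zero there.\<close>
      define H where "H x = d * w x * \<psi>x t x - \<Psi> x * \<psi> t x" for x
      have "((\<lambda>x. d * w x * \<psi>xx t x + f (u x) * \<psi> t x) has_integral H r - H (-r)) {-r..r}"
      proof (rule fundamental_theorem_of_calculus_interior_strong[OF S])
        show "- r \<le> r" using rT by simp
        have "continuous_on A (\<psi>x t)" "continuous_on A (\<psi> t)" for A
          using D[OF t] by (meson DERIV_isCont continuous_at_imp_continuous_on)+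
        then show "continuous_on {-r..r} H"
          unfolding H_def by (intro continuous_intros w continuous_on_subset[OF \<Psi>]) auto
        fix x assume x: "x \<in> {-r<..<r} - S"
        have "(H has_real_derivative (d * ((m + 1) * \<Psi> x)) * \<psi>x t x + \<psi>xx t x * (d * w x)
            - (- f (u x) * \<psi> t x + \<psi>x t x * \<Psi> x)) (at x)"
          unfolding H_def w_def
          using flux[of x] source[of x] x by (intro DERIV_diff DERIV_mult DERIV_cmult D[OF t]) auto
        also have "(d * ((m + 1) * \<Psi> x)) * \<psi>x t x + \<psi>xx t x * (d * w x)
            - (- f (u x) * \<psi> t x + \<psi>x t x * \<Psi> x) = d * w x * \<psi>xx t x + f (u x) * \<psi> t x"
          using d by (simp flip: mult.assoc)
        finally show "(H has_vector_derivative d * w x * \<psi>xx t x + f (u x) * \<psi> t x) (at x)"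
          by (simp add: has_real_derivative_iff_has_vector_derivative)
      qed
      also have "H r - H (-r) = d * b t" using bd[OF t] by (simp add: H_def b_def algebra_simps)
      finally show ?thesis .
    qed
    define A where "A t = integral {-r..r} (\<lambda>x. u x * \<psi>t t x)" for t
    have cont_u: "continuous_on ({0..T} \<times> {-r..r}) (\<lambda>(t, x). u x * \<psi>t t x)"
    proof -
      have "continuous_on ({0..T} \<times> {-r..r}) (\<lambda>p. u (snd p))"
        by (intro continuous_on_compose2[OF u(1)] continuous_intros) auto
      moreover have "continuous_on ({0..T} \<times> {-r..r}) (\<lambda>p. \<psi>t (fst p) (snd p))"
        using continuous_on_subset[OF cont(1), of "{0..T} \<times> {-r..r}"] by (force simp: case_prod_unfold)
      ultimately show ?thesis unfolding case_prod_unfold by (rule continuous_on_mult)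
    qed
    have slice: "continuous_on {-r..r} (\<lambda>x. u x * \<psi>t t x)" if "t \<in> {0..T}" for t
    proof -
      have c: "continuous_on {-r..r} (\<lambda>x. (t, x))"
        by (intro continuous_on_Pair continuous_on_const continuous_on_id)
      have i: "(\<lambda>x. (t, x)) ` {-r..r} \<subseteq> {0..T} \<times> {-r..r}" using that by auto
      show ?thesis using continuous_on_compose2[OF cont_u c i] by simp
    qed
    have int: "integral {-r..r} (\<lambda>x. u x * \<psi>t t x + d * w x * \<psi>xx t x + f (u x) * \<psi> t x) = A t + d * b t"
      if "t \<in> {0..T}" for t
    proof -
      have "((\<lambda>x. u x * \<psi>t t x + (d * w x * \<psi>xx t x + f (u x) * \<psi> t x)) has_integral A t + d * b t) {-r..r}"
        unfolding A_def
        by (intro has_integral_add integrable_integral integrable_continuous_interval slice space that)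
      then show ?thesis by (simp add: integral_unique add.assoc)
    qed
    have contA: "continuous_on {0..T} A"
      using integral_continuous_on_param[of "{0..T}" "-r" r "\<lambda>t x. u x * \<psi>t t x"] cont_u
      unfolding A_def by simp
    have "continuous_on {0..T} (\<lambda>t. \<psi>x t x)" for x
    proof -
      have c: "continuous_on {0..T} (\<lambda>t. (t, x))"
        by (intro continuous_on_Pair continuous_on_const continuous_on_id)
      have i: "(\<lambda>t. (t, x)) ` {0..T} \<subseteq> {0..T} \<times> UNIV" by auto
      show ?thesis using continuous_on_compose2[OF cont(2) c i] by simp
    qed
    then have contb: "continuous_on {0..T} b"
      unfolding b_def by (intro continuous_intros)
    have "integral {0..T} (\<lambda>t. integral {-r..r} (\<lambda>x.
               u x * \<psi>t t x + d * w x * \<psi>xx t x + f (u x) * \<psi> t x))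
        = integral {0..T} (\<lambda>t. A t + d * b t)"
      by (intro integral_cong int)
    also have "\<dots> = integral {0..T} A + d * integral {0..T} b"
      by (subst integral_add)
        (auto intro!: integrable_continuous_interval continuous_intros contA contb)
    also have "integral {0..T} A = integral {-r..r} (\<lambda>x. integral {0..T} (\<lambda>t. u x * \<psi>t t x))"
      using integral_swap_continuous[of 0 "-r" T r "\<lambda>t x. u x * \<psi>t t x"] cont_u
      unfolding A_def by (simp add: cbox_Pair_eq)
    also have "\<dots> = integral {-r..r} (\<lambda>x. u x * \<psi> T x - u x * \<psi> 0 x)"
    proof (rule integral_cong)
      fix x
      have "((\<lambda>t. u x * \<psi>t t x) has_integral u x * \<psi> T x - u x * \<psi> 0 x) {0..T}"
        using rT D(1)
        by (intro fundamental_theorem_of_calculus)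
          (auto simp flip: has_real_derivative_iff_has_vector_derivative intro: DERIV_cmult)
      then show "integral {0..T} (\<lambda>t. u x * \<psi>t t x) = u x * \<psi> T x - u x * \<psi> 0 x"
        by (rule integral_unique)
    qed
    finally show ?thesis by (simp add: b_def[abs_def])
  qed
  show ?thesis
    unfolding weak_solution_def
  proof (intro conjI allI impI)
    fix r T :: real assume rT: "r > 0" "T > 0"
    show "continuous_on ({0<..<T} \<times> UNIV) (\<lambda>(t, x). u x)"
      unfolding case_prod_unfold by (intro continuous_on_compose2[OF u(1)] continuous_intros) auto
    show "\<exists>M. AE (t, x) in lborel. (t, x) \<in> {0<..<T} \<times> UNIV \<longrightarrow> \<bar>u x\<bar> \<le> M"
      using u by (intro exI[of _ 1] AE_I2) auto
    fix \<psi> \<psi>t \<psi>x \<psi>xx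
    assume "C21_strip T \<psi> \<psi>t \<psi>x \<psi>xx" "\<forall>t\<in>{0..T}. \<psi> t r = 0 \<and> \<psi> t (-r) = 0"
    then show "integral {0..T} (\<lambda>t. integral {-r..r} (\<lambda>x.
               u x * \<psi>t t x + 1 / (m + 1) * u x powr (m + 1) * \<psi>xx t x + f (u x) * \<psi> t x))
           = integral {-r..r} (\<lambda>x. u x * \<psi> T x - u x * \<psi> 0 x)
             + 1 / (m + 1) * integral {0..T} (\<lambda>t.
                 u r powr (m + 1) * \<psi>x t r - u (-r) powr (m + 1) * \<psi>x t (-r))"
      using main[OF rT, of \<psi> \<psi>t \<psi>x \<psi>xx] by (simp add: w_def d_def)
  qed (use u in auto)
qed

section \<open>The compacton\<close>

lemma vector_2_axis: "(vector [x, y] :: real^2) = x *\<^sub>R axis 1 1 + y *\<^sub>R axis 2 1"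
  by (simp add: vec_eq_iff forall_2 axis_def)

lemma pulse_homoclinic_orbit: "homoclinic_orbit (D_field 0.3 0) 0 (\<lambda>z. vector [pulse z, pulse_slope z])"
  unfolding homoclinic_orbit_def
proof (intro conjI)
  show "D_field 0.3 0 0 = 0" by (simp add: vec_eq_iff forall_2)
  show "solution_on (D_field 0.3 0) UNIV (\<lambda>z. vector [pulse z, pulse_slope z])"
    unfolding solution_on_def
  proof
    fix z
    have "((\<lambda>z. pulse z *\<^sub>R axis 1 1 + pulse_slope z *\<^sub>R axis 2 1 :: real^2) has_vector_derivative
        (pulse_slope z *\<^sub>R axis 1 1 + (- pulse z * (1 - pulse z) * (pulse z - 0.3)) *\<^sub>R axis 2 1)) (at z)"
      using DERIV_pulse[of z] DERIV_pulse_slope[of z]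
      by (auto intro!: derivative_eq_intros)
    moreover have "D_field 0.3 0 (vector [pulse z, pulse_slope z]) =
        pulse_slope z *\<^sub>R axis 1 1 + (- pulse z * (1 - pulse z) * (pulse z - 0.3)) *\<^sub>R axis 2 1"
      by (simp add: vec_eq_iff forall_2 axis_def)
    ultimately show "((\<lambda>z. vector [pulse z, pulse_slope z] :: real^2) has_vector_derivative
        D_field 0.3 0 (vector [pulse z, pulse_slope z])) (at z within UNIV)"
      by (simp only: vector_2_axis)
  qed
  show "\<exists>z. (vector [pulse z, pulse_slope z] :: real^2) \<noteq> 0"
    using pulse_pos[of 0] by (intro exI[of _ 0]) (auto simp: vec_eq_iff forall_2)
  have "((\<lambda>z. vector [pulse z, pulse_slope z] :: real^2) \<longlongrightarrow> 0) F" if "(pulse \<longlongrightarrow> 0) F" for F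
  proof -
    have "((\<lambda>z. pulse z *\<^sub>R axis 1 1 + pulse_slope z *\<^sub>R axis 2 1 :: real^2)
        \<longlongrightarrow> 0 *\<^sub>R axis 1 1 + 0 *\<^sub>R axis 2 1) F"
      by (intro tendsto_intros that pulse_slope_tendsto_0)
    then show ?thesis by (simp add: vector_2_axis)
  qed
  then show "((\<lambda>z. vector [pulse z, pulse_slope z] :: real^2) \<longlongrightarrow> 0) at_top"
      "((\<lambda>z. vector [pulse z, pulse_slope z] :: real^2) \<longlongrightarrow> 0) at_bot"
    using pulse_at_top pulse_at_bot by blast+
qed

section \<open>Linearization at the origin and the saddle block\<close>

lemma D_field_has_derivative_0:
  "(D_field a c has_derivative (\<lambda>h. vector [h $ 2, a * h $ 1 - c * h $ 2])) (at 0)"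
proof -
  note [derivative_intros] = bounded_linear.has_derivative[OF bounded_linear_vec_nth]
  have "((\<lambda>Y. Y $ 2 *\<^sub>R axis 1 1 + (- c * Y $ 2 - Y $ 1 * (1 - Y $ 1) * (Y $ 1 - a)) *\<^sub>R axis 2 1 :: real^2)
      has_derivative (\<lambda>h. h $ 2 *\<^sub>R axis 1 1 + (a * h $ 1 - c * h $ 2) *\<^sub>R axis 2 1)) (at 0)"
    by (auto intro!: derivative_eq_intros simp: algebra_simps fun_eq_iff)
  then show ?thesis by (simp add: D_field_def[abs_def] vector_2_axis)
qed

text \<open>
  For speed \<open>0\<close> the linearization has eigenvalues \<open>\<plusminus>sqrt a\<close> with eigenvectors \<open>(\<plusminus>1, sqrt a)\<close>
  up to scaling.
\<close>

definition eigenmatrix :: "real \<Rightarrow> real \<Rightarrow> real^2^2" where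
  "eigenmatrix a k = vector [vector [k, - k], vector [k * sqrt a, k * sqrt a]]"

definition eigenmatrix_inv :: "real \<Rightarrow> real \<Rightarrow> real^2^2" where
  "eigenmatrix_inv a k = vector [vector [1 / (2 * k), 1 / (2 * k * sqrt a)],
     vector [- 1 / (2 * k), 1 / (2 * k * sqrt a)]]"

lemma eigenmatrix_inv:
  assumes "a > 0" "k > 0"
  shows "eigenmatrix_inv a k ** eigenmatrix a k = mat 1"
  using assms
  by (simp add: vec_eq_iff forall_2 matrix_matrix_mult_def sum_2 mat_def eigenmatrix_def eigenmatrix_inv_def)

lemma eigenmatrix_at_eigenmatrix:
  assumes a: "a > 0" and k: "k > 0"
  shows "eigenmatrix_at (D_field a 0) 0 (eigenmatrix a k)"
proof -
  have D: "(D_field a 0 has_derivative (\<lambda>h. vector [h $ 2, a * h $ 1 - 0 * h $ 2])) (at 0)"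
    by (rule D_field_has_derivative_0)
  then have diff: "D_field a 0 differentiable (at 0)" by (auto simp: differentiable_def)
  have J: "jacobian (D_field a 0) (at 0) *v h = vector [h $ 2, a * h $ 1]" for h
    using has_derivative_unique[OF D] diff unfolding jacobian_works
    by (metis (no_types, lifting) diff_zero mult_zero_left)
  have col: "column 1 (eigenmatrix a k) = vector [k, k * sqrt a]"
      "column 2 (eigenmatrix a k) = vector [- k, k * sqrt a]"
    by (simp_all add: vec_eq_iff forall_2 column_def eigenmatrix_def)
  have "\<exists>l. jacobian (D_field a 0) (at 0) *v column 1 (eigenmatrix a k) = l *\<^sub>R column 1 (eigenmatrix a k)"
    by (rule exI[of _ "sqrt a"]) (use a in \<open>simp add: J col vec_eq_iff forall_2 mult.left_commute\<close>)
  moreover have "\<exists>l. jacobian (D_field a 0) (at 0) *v column 2 (eigenmatrix a k) = l *\<^sub>R column 2 (eigenmatrix a k)"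
    by (rule exI[of _ "- sqrt a"]) (use a in \<open>simp add: J col vec_eq_iff forall_2 mult.left_commute\<close>)
  moreover have "invertible (eigenmatrix a k)"
    using eigenmatrix_inv[OF a k] by (auto simp: invertible_left_inverse)
  ultimately show ?thesis
    using diff k unfolding eigenmatrix_at_def forall_2
    by (auto simp: col vec_eq_iff forall_2)
qed

text \<open>Subtracting the linear part a x from - x (1 - x) (x - a) leaves x^2 (x - 1 - a). This
  remainder enters only the second component of (D), and both rows of the inverse matrix have the
  same second entry, so the same \<open>q\<close> perturbs both coordinates.\<close>

lemma eigenmatrix_coordinates:
  assumes a: "a > 0" and k: "k > 0"
  defines "x \<equiv> \<lambda>y. k * (y $ 1 - y $ 2)"
  defines "q \<equiv> \<lambda>y. (x y)\<^sup>2 * (x y - 1 - a) / (2 * k * sqrt a)"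
  shows "(eigenmatrix_inv a k *v D_field a 0 (eigenmatrix a k *v y)) $ 1 = sqrt a * y $ 1 + q y"
    and "(eigenmatrix_inv a k *v D_field a 0 (eigenmatrix a k *v y)) $ 2 = - sqrt a * y $ 2 + q y"
proof -
  have P: "(eigenmatrix a k *v y) $ 1 = x y" "(eigenmatrix a k *v y) $ 2 = k * sqrt a * (y $ 1 + y $ 2)"
    by (simp_all add: eigenmatrix_def matrix_vector_mult_def sum_2 x_def algebra_simps)
  have g: "- x y * (1 - x y) * (x y - a) = a * x y + (x y)\<^sup>2 * (x y - 1 - a)"
    by (simp add: power2_eq_square algebra_simps)
  have ax: "a * x y / (2 * k * sqrt a) = sqrt a * (y $ 1 - y $ 2) / 2"
  proof -
    have "a * x y / (2 * k * sqrt a) = (a / sqrt a) * (y $ 1 - y $ 2) / 2"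
      using k by (simp add: x_def)
    then show ?thesis using a by (simp add: real_div_sqrt)
  qed
  have *: "(k * sqrt a * (y $ 1 + y $ 2)) / (2 * k) = sqrt a * (y $ 1 + y $ 2) / 2" using k by simp
  have Q: "(eigenmatrix_inv a k *v Y) $ 1 = Y $ 1 / (2 * k) + Y $ 2 / (2 * k * sqrt a)"
    "(eigenmatrix_inv a k *v Y) $ 2 = - (Y $ 1 / (2 * k)) + Y $ 2 / (2 * k * sqrt a)" for Y
    by (simp_all add: eigenmatrix_inv_def matrix_vector_mult_def sum_2)
  have F2: "D_field a 0 (eigenmatrix a k *v y) $ 2 / (2 * k * sqrt a) = sqrt a * (y $ 1 - y $ 2) / 2 + q y"
    unfolding q_def ax[symmetric] add_divide_distrib[symmetric] g[symmetric] by (simp add: P)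
  show "(eigenmatrix_inv a k *v D_field a 0 (eigenmatrix a k *v y)) $ 1 = sqrt a * y $ 1 + q y"
    "(eigenmatrix_inv a k *v D_field a 0 (eigenmatrix a k *v y)) $ 2 = - sqrt a * y $ 2 + q y"
    unfolding Q F2 by (simp_all add: P(2) *) (simp_all add: field_simps)
qed

text \<open>The first component of P y is at most 1.2 / 10^6 in absolute value on the block, so the
  remainder is at most 3 / 10^12, while the linear part on the edges is at least 0.5477 / 10^7. The
  ranges for \<open>l\<close> and \<open>u\<close> are rounded enclosures of the decimals that
  define \<open>B\<close>.\<close>

lemma saddle_isolating_block:
  defines "P \<equiv> eigenmatrix 0.3 0.877145"
  assumes l: "-1.01 / 10^6 \<le> l $ 1" "l $ 1 \<le> -1 / 10^6" "-1.01 / 10^7 \<le> l $ 2" "l $ 2 \<le> -1 / 10^7"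
    and u: "1 / 10^6 \<le> u $ 1" "u $ 1 \<le> 1.01 / 10^6" "1 / 10^7 \<le> u $ 2" "u $ 2 \<le> 1.01 / 10^7"
  shows "isolating_block (D_field 0.3 0) ((\<lambda>y. P *v y) ` cbox l u)"
proof -
  define s :: real where "s = sqrt 0.3"
  have s: "s > 0.5477" using sqrt_3_10_bounds by (simp add: s_def)
  define x where "x y = 0.877145 * (y $ 1 - y $ 2)" for y :: "real^2"
  define q where "q y = (x y)\<^sup>2 * (x y - 1 - 0.3) / (2 * 0.877145 * s)" for y
  have small: "\<bar>q y\<bar> \<le> 3 / 10^12" if "y \<in> cbox l u" for y
  proof -
    have "\<bar>x y\<bar> \<le> 1.2 / 10^6"
    proof (rule abs_leI)
      have "l $ 1 \<le> y $ 1" "y $ 1 \<le> u $ 1" "l $ 2 \<le> y $ 2" "y $ 2 \<le> u $ 2"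
        using that by (auto simp: mem_box_cart)
      then show "x y \<le> 1.2 / 10^6" "- x y \<le> 1.2 / 10^6"
        using l u by (simp_all add: x_def field_simps)
    qed
    then have "\<bar>x y\<bar>\<^sup>2 \<le> (1.2 / 10^6)\<^sup>2" and "\<bar>x y - 1 - 0.3\<bar> \<le> 1.4"
      by (rule power_mono, simp) (use \<open>\<bar>x y\<bar> \<le> 1.2 / 10^6\<close> in \<open>auto simp: abs_le_iff\<close>)
    then have "\<bar>(x y)\<^sup>2 * (x y - 1 - 0.3)\<bar> \<le> (1.2 / 10^6)\<^sup>2 * 1.4"
      unfolding abs_mult by (intro mult_mono) auto
    then have "\<bar>q y\<bar> \<le> ((1.2 / 10^6)\<^sup>2 * 1.4) / (2 * 0.877145 * 0.5477)"
      unfolding q_def abs_divide using s by (intro frac_le) auto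
    then show ?thesis by (simp add: power2_eq_square)
  qed
  have coord: "(eigenmatrix_inv 0.3 0.877145 *v D_field 0.3 0 (eigenmatrix 0.3 0.877145 *v y)) $ 1 = s * y $ 1 + q y"
    "(eigenmatrix_inv 0.3 0.877145 *v D_field 0.3 0 (eigenmatrix 0.3 0.877145 *v y)) $ 2 = - s * y $ 2 + q y" for y
    unfolding s_def q_def x_def by (rule eigenmatrix_coordinates; simp)+
  have s1: "s * v \<ge> 0.5477 / 10^6" if "v \<ge> 1 / 10^6" for v
    using mult_mono[of "0.5477" s "1 / 10^6" v] that s by simp
  have s2: "s * v \<ge> 0.5477 / 10^7" if "v \<ge> 1 / 10^7" for v
    using mult_mono[of "0.5477" s "1 / 10^7" v] that s by simp
  show ?thesis
    unfolding P_def
  proof (rule isolating_block_parallelogram[OF eigenmatrix_inv])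
    fix y assume y: "y \<in> cbox l u"
    show "(eigenmatrix_inv 0.3 0.877145 *v D_field 0.3 0 (eigenmatrix 0.3 0.877145 *v y)) $ 1 > 0"
      if "y $ 1 = u $ 1"
      using small[OF y] s1[of "y $ 1"] that u unfolding coord by (simp add: abs_le_iff)
    show "(eigenmatrix_inv 0.3 0.877145 *v D_field 0.3 0 (eigenmatrix 0.3 0.877145 *v y)) $ 1 < 0"
      if "y $ 1 = l $ 1"
      using small[OF y] s1[of "- (y $ 1)"] that l unfolding coord by (simp add: abs_le_iff)
    show "(eigenmatrix_inv 0.3 0.877145 *v D_field 0.3 0 (eigenmatrix 0.3 0.877145 *v y)) $ 2 < 0"
      if "y $ 2 = u $ 2"
      using small[OF y] s2[of "y $ 2"] that u unfolding coord by (simp add: abs_le_iff)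
    show "(eigenmatrix_inv 0.3 0.877145 *v D_field 0.3 0 (eigenmatrix 0.3 0.877145 *v y)) $ 2 > 0"
      if "y $ 2 = l $ 2"
      using small[OF y] s2[of "- (y $ 2)"] that l unfolding coord by (simp add: abs_le_iff)
  next
    show "\<exists>\<delta> \<sigma>. \<delta> > 0 \<and> solution_on (D_field 0.3 0) {0..\<delta>} \<sigma> \<and> \<sigma> 0 = x0" for x0
      using D_field_local_solution[of "0.3" 0 x0] by blast
  qed (use l u in auto)
qed

section \<open>The profile in the wave variable and the final theorem\<close>

lemma pulse_compacton:
  obtains L z where "L > 0" "2 * L \<in> {5.7503277707 .. 5.8115725019}" "bij_betw z {-L<..<L} UNIV"
    "\<And>\<xi>. \<xi> \<in> {-L<..<L} \<Longrightarrow> (z has_real_derivative pulse (z \<xi>) powr (- (3/4))) (at \<xi>)"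
    "weak_solution (3/4) (\<lambda>v. v powr (1/4) * (1 - v) * (v - 0.3))
       (\<lambda>\<xi>. if \<xi> \<in> {-L<..<L} then pulse (z \<xi>) else 0)
       (\<lambda>t \<xi>. if \<xi> \<in> {-L<..<L} then pulse (z \<xi>) else 0)"
proof -
  obtain X L where X: "\<And>z. (X has_real_derivative pulse z powr (3/4)) (at z)"
    "\<And>z. X (- z) = - X z" "(X \<longlongrightarrow> L) at_top" and L2: "2 * L \<in> {5.7503277707 .. 5.8115725019}"
    by (rule pulse_wave_variable) blast
  have g: "pulse t powr (3/4) > 0" for t using pulse_pos[of t] by simp
  obtain z where L: "L > 0" and z: "bij_betw z {-L<..<L} UNIV"
    and z': "\<And>\<xi>. \<xi> \<in> {-L<..<L} \<Longrightarrow> (z has_real_derivative inverse (pulse (z \<xi>) powr (3/4))) (at \<xi>)"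
    and lim: "filterlim z at_top (at_left L)" "filterlim z at_bot (at_right (- L))"
    by (rule odd_bounded_primitive_inverse[OF X(1) g X(2,3)]) blast
  have D: "(z has_real_derivative pulse (z \<xi>) powr (- (3/4))) (at \<xi>)" if "\<xi> \<in> {-L<..<L}" for \<xi>
    using z'[OF that] by (simp add: powr_minus)
  define u where "u \<xi> = (if \<xi> \<in> {-L<..<L} then pulse (z \<xi>) else 0)" for \<xi>
  define \<Psi> where "\<Psi> \<xi> = (if \<xi> \<in> {-L<..<L} then pulse_slope (z \<xi>) else 0)" for \<xi>
  have compose: "isCont (\<lambda>\<xi>. if \<xi> \<in> {-L<..<L} then h (z \<xi>) else 0) \<xi>"
    if "\<And>t. isCont h t" "(h \<longlongrightarrow> 0) at_top" "(h \<longlongrightarrow> 0) at_bot" for h :: "real \<Rightarrow> real" and \<xi>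
  proof (rule isCont_zero_extension[OF L])
    show "isCont (\<lambda>\<xi>. h (z \<xi>)) \<xi>" if "\<xi> \<in> {-L<..<L}" for \<xi>
      by (rule isCont_o2[OF DERIV_isCont[OF D[OF that]]]) (fact \<open>\<And>t. isCont h t\<close>)
  qed (use that lim filterlim_compose in blast)+
  have u_cont: "continuous_on UNIV u"
    unfolding u_def
    by (intro continuous_at_imp_continuous_on ballI compose DERIV_isCont[OF DERIV_pulse] pulse_at_top pulse_at_bot)
  have \<Psi>_cont: "continuous_on UNIV \<Psi>"
    unfolding \<Psi>_def
    by (intro continuous_at_imp_continuous_on ballI compose DERIV_isCont[OF DERIV_pulse_slope]
        pulse_slope_tendsto_0 pulse_at_top pulse_at_bot)
  have outside: "(h has_real_derivative 0) (at \<xi>)"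
    if h: "\<And>x. x \<notin> {-L<..<L} \<Longrightarrow> h x = 0" and \<xi>: "\<xi> \<notin> {-L..L}" for h :: "real \<Rightarrow> real" and \<xi>
  proof -
    have "((\<lambda>_. 0) has_real_derivative 0) (at \<xi>)" by simp
    then show ?thesis
      by (rule has_field_derivative_transform_within_open[of _ _ _ "- {-L..L}"]) (use h \<xi> in auto)
  qed
  have inside: "(h has_real_derivative d) (at \<xi>)"
    if "(k has_real_derivative d) (at \<xi>)" "\<xi> \<in> {-L<..<L}" "\<And>x. x \<in> {-L<..<L} \<Longrightarrow> h x = k x"
    for h k :: "real \<Rightarrow> real" and \<xi> d
    using that by (intro has_field_derivative_transform_within_open[of k d \<xi> "{-L<..<L}" h]) auto
  have "weak_solution (3/4) (\<lambda>v. v powr (1/4) * (1 - v) * (v - 0.3)) u (\<lambda>t. u)"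
  proof (rule stationary_weak_solution[where S = "{-L, L}" and \<Psi> = \<Psi>])
    show "0 \<le> u x" "u x \<le> 1" for x
      using pulse_pos[of "z x"] pulse_less_1[of "z x"] by (auto simp: u_def)
    fix x assume x: "x \<notin> {-L, L}"
    show "((\<lambda>x. u x powr (3/4 + 1)) has_real_derivative (3/4 + 1) * \<Psi> x) (at x)"
    proof (cases "x \<in> {-L<..<L}")
      case True
      have "((\<lambda>x. pulse (z x)) has_real_derivative pulse_slope (z x) * pulse (z x) powr (- (3/4))) (at x)"
        by (rule DERIV_chain2[where f = pulse, OF DERIV_pulse D[OF True]])
      then have "((\<lambda>x. pulse (z x) powr (3/4 + 1)) has_real_derivative
          (3/4 + 1) * pulse (z x) powr (3/4 + 1 - 1) * (pulse_slope (z x) * pulse (z x) powr (- (3/4)))) (at x)"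
        using pulse_pos[of "z x"] by (auto intro!: derivative_eq_intros simp: powr_diff)
      \<comment> \<open>The degenerate factor \<phi>^(3/4) of the diffusion cancels dz/d\<xi> =
        \<phi>^(-3/4), leaving the slope in the variable z.\<close>
      also have "(3/4 + 1) * pulse (z x) powr (3/4 + 1 - 1) * (pulse_slope (z x) * pulse (z x) powr (- (3/4)))
          = (3/4 + 1) * \<Psi> x"
        using True pulse_pos[of "z x"] by (simp add: \<Psi>_def powr_minus)
      finally show ?thesis by (rule inside) (use True in \<open>auto simp: u_def\<close>)
    next
      case False
      then have "\<Psi> x = 0" by (auto simp: \<Psi>_def)
      moreover have "((\<lambda>x. u x powr (3/4 + 1)) has_real_derivative 0) (at x)"
        by (rule outside) (use x False in \<open>auto simp: u_def\<close>)
      ultimately show ?thesis by simp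
    qed
    show "(\<Psi> has_real_derivative - (u x powr (1/4) * (1 - u x) * (u x - 0.3))) (at x)"
    proof (cases "x \<in> {-L<..<L}")
      case True
      define p where "p = pulse (z x)"
      \<comment> \<open>Here m + p = 1 enters: since 1/4 = 1 - 3/4, the cubic of (D) times dz/d\<xi>
        is the reaction term.\<close>
      have "p powr (1/4) = p powr (1 + - (3/4))" by simp
      also have "\<dots> = p * p powr (- (3/4))"
        using pulse_pos[of "z x"] by (subst powr_add) (simp add: p_def)
      finally have p: "p powr (1/4) = p * p powr (- (3/4))" .
      have "((\<lambda>x. pulse_slope (z x)) has_real_derivative
          - p * (1 - p) * (p - 0.3) * p powr (- (3/4))) (at x)"
        unfolding p_def by (rule DERIV_chain2[where f = pulse_slope, OF DERIV_pulse_slope D[OF True]])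
      also have "- p * (1 - p) * (p - 0.3) * p powr (- (3/4)) = - (u x powr (1/4) * (1 - u x) * (u x - 0.3))"
        using True by (simp add: u_def p_def[symmetric] p)
      finally show ?thesis by (rule inside) (use True in \<open>auto simp: \<Psi>_def\<close>)
    next
      case False
      then have "u x = 0" by (auto simp: u_def)
      moreover have "(\<Psi> has_real_derivative 0) (at x)"
        by (rule outside) (use x False in \<open>auto simp: \<Psi>_def\<close>)
      ultimately show ?thesis by simp
    qed
  qed (use u_cont \<Psi>_cont in auto)
  then show thesis
    using that[OF L L2 z D] by (simp add: u_def[abs_def])
qed

theorem mainTheorem5:
  fixes m p a :: real and f :: "real \<Rightarrow> real" and B :: "(real^2) set"
  assumes m: "m = 3/4" and p: "p = 1/4" and a: "a = 0.3"
    and f: "f = (\<lambda>v. v powr p * (1 - v) * (v - a))"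
    and B: "B = cbox (vector [-1.0000068275040609 / 10^6, -1.0000261784559085 / 10^7])
                     (vector [1.0000038705938853 / 10^6, 1.0000461805915562 / 10^7])"
  shows "\<exists>c\<in>{-1.5 / 10^6 .. 1.5 / 10^6}. \<exists>\<xi>min \<xi>max :: real. \<exists>\<phi> \<Phi> :: real \<Rightarrow> real.
     \<xi>min < \<xi>max \<and>
     \<phi> = (\<lambda>\<xi>. if \<xi> \<in> {\<xi>min<..<\<xi>max} then \<Phi> \<xi> else 0) \<and>
     compacton_traveling_wave m f c \<phi> \<and>
     (\<exists>(Y :: real \<Rightarrow> real^2) (z :: real \<Rightarrow> real).
        homoclinic_orbit (D_field a c) 0 Y \<and>
        bij_betw z {\<xi>min<..<\<xi>max} UNIV \<and>
        (\<forall>\<xi>\<in>{\<xi>min<..<\<xi>max}.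
           \<Phi> \<xi> > 0 \<and>
           (z has_real_derivative \<phi> \<xi> powr (-m)) (at \<xi>) \<and>
           \<Phi> \<xi> = Y (z \<xi>) $ 1)) \<and>
     (\<exists>P :: real^2^2.
        eigenmatrix_at (D_field a c) 0 P \<and>
        column 1 P \<in> cbox (vector [0.87714184587409483, 0.48042765940975440])
                          (vector [0.87714960433934953, 0.48043734031068247]) \<and>
        column 2 P \<in> cbox (vector [-0.87714960433700939, 0.48042765939685023])
                          (vector [-0.87714184587344934, 0.48043734034727664]) \<and>
        isolating_block (D_field a c) ((\<lambda>y. P *v y) ` B) \<and>
        0 \<in> (\<lambda>y. P *v y) ` B) \<and>
     (\<forall>t\<ge>0. measure lborel (supp (\<lambda>x. \<phi> (x - c * t))) = \<xi>max - \<xi>min) \<and>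
     \<xi>max - \<xi>min \<in> {5.7503277707 .. 5.8115725019}"
proof -
  obtain L z where L: "L > 0" "2 * L \<in> {5.7503277707 .. 5.8115725019}" and z: "bij_betw z {-L<..<L} UNIV"
    and z': "\<And>\<xi>. \<xi> \<in> {-L<..<L} \<Longrightarrow> (z has_real_derivative pulse (z \<xi>) powr (- (3/4))) (at \<xi>)"
    and weak: "weak_solution (3/4) (\<lambda>v. v powr (1/4) * (1 - v) * (v - 0.3))
       (\<lambda>\<xi>. if \<xi> \<in> {-L<..<L} then pulse (z \<xi>) else 0)
       (\<lambda>t \<xi>. if \<xi> \<in> {-L<..<L} then pulse (z \<xi>) else 0)"
    by (rule pulse_compacton) blast
  define \<Phi> where "\<Phi> \<xi> = pulse (z \<xi>)" for \<xi>
  define \<phi> where "\<phi> = (\<lambda>\<xi>. if \<xi> \<in> {-L<..<L} then \<Phi> \<xi> else 0)"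
  have "{x. \<phi> x \<noteq> 0} = {-L<..<L}"
    using pulse_pos by (auto simp: \<phi>_def \<Phi>_def less_imp_neq[symmetric])
  then have supp: "supp \<phi> = {-L..L}"
    using L by (simp add: supp_def)
  have "weak_solution (3/4) (\<lambda>v. v powr (1/4) * (1 - v) * (v - 0.3)) \<phi> (\<lambda>t. \<phi>)"
    using weak unfolding \<phi>_def \<Phi>_def .
  then have compacton: "compacton_traveling_wave m f 0 \<phi>"
    by (simp add: compacton_traveling_wave_def traveling_wave_def supp m f p a)
  \<comment> \<open>The scale 0.877145 lies in the prescribed range for the first entries (up to
    sign), and its product with sqrt 0.3 in the range for the second entries. Unit length would give
    the first entry 1 / sqrt 1.3, about 0.87706, outside the enclosure.\<close>
  define P :: "real^2^2" where "P = eigenmatrix 0.3 0.877145"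
  \<comment> \<open>The enclosures of the second entries are only about 1 / 10^5 wide, finer than
    \<open>sqrt_3_10_bounds\<close> resolves.\<close>
  have sqrt: "0.547722 < sqrt 0.3" "sqrt 0.3 < 0.547723"
    by (rule real_less_rsqrt real_less_lsqrt; simp add: power2_eq_square)+
  have col: "column 1 P = vector [0.877145, 0.877145 * sqrt 0.3]"
      "column 2 P = vector [- 0.877145, 0.877145 * sqrt 0.3]"
    by (simp_all add: vec_eq_iff forall_2 column_def eigenmatrix_def P_def)
  have block: "isolating_block (D_field a 0) ((\<lambda>y. P *v y) ` B)"
    unfolding B a P_def by (rule saddle_isolating_block) auto
  have zero: "0 \<in> (\<lambda>y. P *v y) ` B"
    by (rule image_eqI[of _ _ 0]) (auto simp: B mem_box_cart forall_2)
  have columns: "column 1 P \<in> cbox (vector [0.87714184587409483, 0.48042765940975440])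
                          (vector [0.87714960433934953, 0.48043734031068247])"
    "column 2 P \<in> cbox (vector [-0.87714960433700939, 0.48042765939685023])
                          (vector [-0.87714184587344934, 0.48043734034727664])"
    using sqrt by (auto simp: col mem_box_cart forall_2)
  have eigen: "eigenmatrix_at (D_field a 0) 0 P"
    unfolding a P_def by (rule eigenmatrix_at_eigenmatrix) auto
  have orbit: "homoclinic_orbit (D_field a 0) 0 (\<lambda>z. vector [pulse z, pulse_slope z])"
    unfolding a by (rule pulse_homoclinic_orbit)
  have frame: "\<forall>\<xi>\<in>{-L<..<L}. \<Phi> \<xi> > 0 \<and> (z has_real_derivative \<phi> \<xi> powr (-m)) (at \<xi>) \<and>
      \<Phi> \<xi> = (\<lambda>z. vector [pulse z, pulse_slope z] :: real^2) (z \<xi>) $ 1"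
    using z' pulse_pos by (auto simp: \<phi>_def \<Phi>_def m)
  show ?thesis
  proof (rule bexI[of _ 0], rule exI[of _ "- L"], rule exI[of _ L], rule exI[of _ \<phi>],
      rule exI[of _ \<Phi>], intro conjI)
    show "\<phi> = (\<lambda>\<xi>. if \<xi> \<in> {-L<..<L} then \<Phi> \<xi> else 0)" by (fact \<phi>_def)
    show "compacton_traveling_wave m f 0 \<phi>" by fact
    show "\<exists>(Y :: real \<Rightarrow> real^2) z. homoclinic_orbit (D_field a 0) 0 Y \<and> bij_betw z {-L<..<L} UNIV \<and>
        (\<forall>\<xi>\<in>{-L<..<L}. \<Phi> \<xi> > 0 \<and> (z has_real_derivative \<phi> \<xi> powr (-m)) (at \<xi>) \<and>
           \<Phi> \<xi> = Y (z \<xi>) $ 1)"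
      using orbit z frame by blast
    show "\<exists>P :: real^2^2.
        eigenmatrix_at (D_field a 0) 0 P \<and>
        column 1 P \<in> cbox (vector [0.87714184587409483, 0.48042765940975440])
                          (vector [0.87714960433934953, 0.48043734031068247]) \<and>
        column 2 P \<in> cbox (vector [-0.87714960433700939, 0.48042765939685023])
                          (vector [-0.87714184587344934, 0.48043734034727664]) \<and>
        isolating_block (D_field a 0) ((\<lambda>y. P *v y) ` B) \<and>
        0 \<in> (\<lambda>y. P *v y) ` B"
      using eigen columns block zero by blast
    show "\<forall>t\<ge>0. measure lborel (supp (\<lambda>x. \<phi> (x - 0 * t))) = L - (- L)"
      using L by (simp add: supp)
    show "L - (- L) \<in> {5.7503277707 .. 5.8115725019}" "- L < L" using L by simp_all
  qed simp
qed

end
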